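(* Let $\Sigma_0,\Sigma_1\in\mathbb S_\succ^d$, $p>d-1$, let $\mu_i=\mathcal W_d(\Sigma_i,p)$ be Wishart distributions, $i=0,1$, and let $c(X,Y)=\|X-Y\|_{\mathrm F}^2$. Set $C=(\Sigma_0^{1/2}\Sigma_1\Sigma_0^{1/2})^{1/2}$. Then: (a) the unique optimal Monge map from $\mu_0$ to $\mu_1$ is $T^\star(X)=A^\star XA^\star$, where $A^\star=\Sigma_0^{-1/2}(\Sigma_0^{1/2}\Sigma_1\Sigma_0^{1/2})^{1/2}\Sigma_0^{-1/2}$; (b) $(\mathrm{id}_{\mathbb S_\succ^d},T^\star)_\#\mu_0$ is the unique optimal Kantorovich plan; (c) $\mathds K_c(\mu_0,\mu_1)=p(p+1)\|\Sigma_0-\Sigma_1\|_{\mathrm F}^2+p\bigl((\mathrm{Tr}\,\Sigma_0)^2+(\mathrm{Tr}\,\Sigma_1)^2-2(\mathrm{Tr}\,C)^2\bigr)$; (d) $\mathds M_c(\mu_0,\mu_1)=\mathds K_c(\mu_0,\mu_1)$.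
   Context: $\mathbb S_\succ^d$ is the cone of real symmetric positive definite $d\times d$ matrices ($d\ge1$); $\|\cdot\|_{\mathrm F}$ is the Frobenius norm; square roots are the positive definite ones; $T_\#\mu(B)=\mu(T^{-1}(B))$. For $\Sigma\in\mathbb S_\succ^d$ and real $p>d-1$, the Wishart distribution $\mathcal W_d(\Sigma,p)$ is the probability law on $\mathbb S_\succ^d$ with density $$X\mapsto\frac{\det(X)^{(p-d-1)/2}\exp(-\tfrac12\mathrm{Tr}(\Sigma^{-1}X))}{2^{pd/2}\det(\Sigma)^{p/2}\,\mathsf\Gamma_d(p/2)}$$ with respect to $\prod_{1\le i\le j\le d}dX_{ij}$, where $\mathsf\Gamma_d(a)=\pi^{d(d-1)/4}\prod_{j=1}^d\Gamma(a-\frac{j-1}2)$. With $\mathcal X=\mathbb S_\succ^d$: $\mathds M_c(\mu_0,\mu_1)=\inf_T\int c(X,T(X))\,d\mu_0(X)$ over Borel $T:\mathcal X\to\mathcal X$ with $T_\#\mu_0=\mu_1$ (a minimizer is an optimal Monge map; uniqueness is up to $\mu_0$-a.e. equality); $\mathds K_c(\mu_0,\mu_1)=\inf_\Gamma\int c\,d\Gamma$ over probability measures $\Gamma$ on $\mathcal X\times\mathcal X$ with marginals $\mu_0,\mu_1$ (a minimizer is an optimal Kantorovich plan). *)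

theory Defs
  imports "HOL-Probability.Probability"
begin

definition spd :: "(real^'n^'n) set" where
  "spd = {X. transpose X = X \<and> (\<forall>v. v \<noteq> 0 \<longrightarrow> 0 < v \<bullet> (X *v v))}"

definition spd_sqrt :: "real^'n^'n \<Rightarrow> real^'n^'n" where
  "spd_sqrt X = (THE Y. Y \<in> spd \<and> Y ** Y = X)"

(* A symmetric matrix is determined by its entries with i \<le> j, i.e. by one coordinate
   for each unordered pair {i, j} (with {i, i} = {i} for the diagonal).  Indexing the
   coordinates by unordered pairs avoids choosing a linear order on 'n. *)

definition sym_of_coords :: "('n set \<Rightarrow> real) \<Rightarrow> real^'n^'n" where
  "sym_of_coords x = (\<chi> i j. x {i, j})"

definition spd_lebesgue :: "(real^'n^'n) measure" where
  "spd_lebesgue =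
     restrict_space
       (distr (\<Pi>\<^sub>M e\<in>range (\<lambda>(i, j). {i, j} :: 'n set). lborel) borel sym_of_coords) spd"

definition multigamma :: "nat \<Rightarrow> real \<Rightarrow> real" where
  "multigamma d a =
     pi powr (real d * (real d - 1) / 4) * (\<Prod>j=1..d. Gamma (a - (real j - 1) / 2))"

definition wishart_density :: "real^'n^'n \<Rightarrow> real \<Rightarrow> real^'n^'n \<Rightarrow> real" where
  "wishart_density S p X =
     det X powr ((p - real CARD('n) - 1) / 2) * exp (- (1/2) * trace (matrix_inv S ** X))
     / (2 powr (p * real CARD('n) / 2) * det S powr (p / 2) * multigamma CARD('n) (p / 2))"

definition wishart :: "real^'n^'n \<Rightarrow> real \<Rightarrow> (real^'n^'n) measure" where
  "wishart S p = density spd_lebesgue (\<lambda>X. ennreal (wishart_density S p X))"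

lemma space_wishart: "space (wishart S p) = spd"
  by (simp add: wishart_def spd_lebesgue_def space_restrict_space)

lemma sets_wishart [measurable_cong]: "sets (wishart S p) = sets (restrict_space borel spd)"
  by (simp add: wishart_def spd_lebesgue_def sets_restrict_space)


definition transport_maps :: "'a measure \<Rightarrow> 'b measure \<Rightarrow> ('a \<Rightarrow> 'b) set" where
  "transport_maps \<mu> \<nu> = {T \<in> measurable \<mu> \<nu>. distr \<mu> \<nu> T = \<nu>}"

definition couplings :: "'a measure \<Rightarrow> 'b measure \<Rightarrow> ('a \<times> 'b) measure set" where
  "couplings \<mu> \<nu> =
     {\<Gamma>. prob_space \<Gamma> \<and> sets \<Gamma> = sets (\<mu> \<Otimes>\<^sub>M \<nu>) \<and> distr \<Gamma> \<mu> fst = \<mu> \<and> distr \<Gamma> \<nu> snd = \<nu>}"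

definition monge_cost ::
  "('a \<Rightarrow> 'b \<Rightarrow> ennreal) \<Rightarrow> 'a measure \<Rightarrow> ('a \<Rightarrow> 'b) \<Rightarrow> ennreal" where
  "monge_cost c \<mu> T = (\<integral>\<^sup>+x. c x (T x) \<partial>\<mu>)"

definition kantorovich_cost ::
  "('a \<Rightarrow> 'b \<Rightarrow> ennreal) \<Rightarrow> ('a \<times> 'b) measure \<Rightarrow> ennreal" where
  "kantorovich_cost c \<Gamma> = (\<integral>\<^sup>+(x, y). c x y \<partial>\<Gamma>)"

definition monge ::
  "('a \<Rightarrow> 'b \<Rightarrow> ennreal) \<Rightarrow> 'a measure \<Rightarrow> 'b measure \<Rightarrow> ennreal" where
  "monge c \<mu> \<nu> = (INF T\<in>transport_maps \<mu> \<nu>. monge_cost c \<mu> T)"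

definition kantorovich ::
  "('a \<Rightarrow> 'b \<Rightarrow> ennreal) \<Rightarrow> 'a measure \<Rightarrow> 'b measure \<Rightarrow> ennreal" where
  "kantorovich c \<mu> \<nu> = (INF \<Gamma>\<in>couplings \<mu> \<nu>. kantorovich_cost c \<Gamma>)"

definition optimal_monge_map ::
  "('a \<Rightarrow> 'b \<Rightarrow> ennreal) \<Rightarrow> 'a measure \<Rightarrow> 'b measure \<Rightarrow> ('a \<Rightarrow> 'b) \<Rightarrow> bool" where
  "optimal_monge_map c \<mu> \<nu> T \<longleftrightarrow>
     T \<in> transport_maps \<mu> \<nu> \<and> monge_cost c \<mu> T = monge c \<mu> \<nu>"

definition optimal_plan ::
  "('a \<Rightarrow> 'b \<Rightarrow> ennreal) \<Rightarrow> 'a measure \<Rightarrow> 'b measure \<Rightarrow> ('a \<times> 'b) measure \<Rightarrow> bool" where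
  "optimal_plan c \<mu> \<nu> \<Gamma> \<longleftrightarrow>
     \<Gamma> \<in> couplings \<mu> \<nu> \<and> kantorovich_cost c \<Gamma> = kantorovich c \<mu> \<nu>"

(* The library norm on real^'n^'n is the l2-norm of all entries, i.e. the Frobenius norm. *)

definition frob_cost :: "real^'n^'n \<Rightarrow> real^'n^'n \<Rightarrow> ennreal" where
  "frob_cost X Y = ennreal ((norm (X - Y))\<^sup>2)"

end

theory Submission
  imports Defs
begin

text \<open>
  The matrix A of the statement is positive definite and satisfies A \<Sigma>0 A = \<Sigma>1
  (\<open>wishart_brenier_matrix\<close>). Let B be its positive definite root and B' the inverse of B. Since the
  Frobenius inner product of B X B and B' Y B' equals that of X and Y, expanding squares gives
  (\<open>quadratic_cost_identity\<close>)

    |X - Y|^2 = |X|^2 + |Y|^2 - |B X B|^2 - |B' Y B'|^2 + |B X B - B' Y B'|^2.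

  Integrated over a coupling, the first four terms depend on the marginals only. So the cost of every
  plan is one constant K plus the integral of the last term, which is nonnegative and vanishes exactly
  when Y = A X A almost everywhere. Optimality and uniqueness of the map and of the plan, and equality
  of the two infima, follow at once, as soon as the map transports the measures and the second moments
  are finite; their values give K.

  For the transport property, a congruence X \<mapsto> G X G^T maps the Wishart law with scale S to the one with
  scale G S G^T (\<open>distr_wishart_congruence\<close>). This rests on the Jacobian |det G| ^ (d + 1) of a congruence
  on the space of symmetric matrices (\<open>nn_integral_sym_lebesgue_congruence\<close>). The Jacobian formula is
  multiplicative in G, so it suffices to check it for diagonal matrices, transpositions and transvections,
  which act on the coordinates by scaling, by permutation and by shears. The same fact shows that B X B
  and B' Y B' have the same law, the Wishart law with scale B \<Sigma>0 B.

  The second moment is p (p + 1) |S|^2 + p (tr S)^2 (\<open>nn_integral_norm_squared_wishart\<close>). Diagonalizing S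
  reduces it to the second moments of single entries for the identity scale. These, and the
  normalizing constant, come from splitting off one diagonal entry s as a pivot: in terms of s, the rest v
  of its row and the Schur complement, the density factorizes into a Gamma density in s, centred Gaussian
  densities of variance s in v, and a density of the same form for the Schur complement
  (\<open>nn_integral_partial_weight_pivot\<close>). Iterating over the index set computes the total mass, and
  weighting the first step by s^2 or by the square of an entry of v computes the moments.
\<close>

section \<open>Spectral theorem and positive definite matrices\<close>

lemma inner_matrix_vector_mult:
  fixes M :: "real^'n^'m"
  shows "x \<bullet> (M *v y) = (transpose M *v x) \<bullet> y"
  by (metis dot_lmul_matrix transpose_matrix_vector)

text \<open>
  A maximizer v of the quadratic form on the unit sphere of V is an eigenvector: the residual
  r = N v - c v is orthogonal to v and lies in V, and moving from v towards r changes the form to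
  first order by twice the squared norm of r, which maximality forces to vanish.
\<close>

lemma rayleigh_maximizer_eigenvector:
  fixes N :: "real^'n^'n"
  assumes sym: "transpose N = N" and V: "subspace V" "\<And>v. v \<in> V \<Longrightarrow> N *v v \<in> V"
    and ne: "V \<noteq> {0}"
  obtains v c where "v \<in> V" "norm v = 1" "N *v v = c *\<^sub>R v"
proof -
  let ?f = "\<lambda>v. v \<bullet> (N *v v)"
  let ?S = "sphere 0 1 \<inter> V"
  have "compact ?S"
    by (intro compact_Int_closed closed_subspace V compact_sphere)
  moreover have "?S \<noteq> {}"
  proof -
    from ne V(1) obtain u where "u \<in> V" "u \<noteq> 0" using subspace_0 by blast
    then have "(1 / norm u) *\<^sub>R u \<in> ?S" using V(1) by (simp add: subspace_scale)
    then show ?thesis by blast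
  qed
  moreover have "continuous_on ?S ?f"
    by (intro continuous_intros)
  ultimately obtain v where v: "v \<in> ?S" and max: "\<And>w. w \<in> ?S \<Longrightarrow> ?f w \<le> ?f v"
    using continuous_attains_sup[of ?S ?f] by blast
  define c where "c = ?f v"
  have vV: "v \<in> V" and nv: "v \<bullet> v = 1" using v by (auto simp: norm_eq_1)
  have bound: "?f w \<le> c * (w \<bullet> w)" if "w \<in> V" for w
  proof (cases "w = 0")
    case False
    have "(1 / norm w) *\<^sub>R w \<in> ?S" using that False V(1) by (simp add: subspace_scale)
    from max[OF this] have "?f w / (norm w * norm w) \<le> c"
      by (simp add: c_def matrix_vector_mult_scaleR)
    then show ?thesis using False by (simp add: field_simps power2_norm_eq_inner[symmetric] power2_eq_square)
  qed simp
  define r where "r = N *v v - c *\<^sub>R v"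
  have rV: "r \<in> V" unfolding r_def using V vV by (simp add: subspace_diff subspace_scale)
  have rv: "r \<bullet> v = 0" by (simp add: r_def inner_diff_left nv c_def) (simp add: inner_commute)
  \<comment> \<open>First-order optimality at v in the direction of the residual r.\<close>
  have "2 * t * (r \<bullet> r) + t\<^sup>2 * (?f r - c * (r \<bullet> r)) \<le> 0" for t
  proof -
    have "v + t *\<^sub>R r \<in> V" using V(1) vV rV by (simp add: subspace_add subspace_scale)
    note b = bound[OF this]
    have "v \<bullet> (N *v r) = r \<bullet> (N *v v)"
      using inner_matrix_vector_mult[of v N r] sym by (simp add: inner_commute)
    moreover have "r \<bullet> (N *v v) = r \<bullet> r"
      using rv by (simp add: r_def inner_diff_right)
    ultimately have "?f (v + t *\<^sub>R r) = c + 2 * t * (r \<bullet> r) + t\<^sup>2 * ?f r"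
      by (simp add: matrix_vector_right_distrib matrix_vector_mult_scaleR inner_add_left
          inner_add_right c_def power2_eq_square algebra_simps)
    moreover have "(v + t *\<^sub>R r) \<bullet> (v + t *\<^sub>R r) = 1 + t\<^sup>2 * (r \<bullet> r)"
      using rv by (simp add: inner_add_left inner_add_right nv inner_commute power2_eq_square)
    ultimately show ?thesis using b by (simp add: algebra_simps)
  qed note key = this
  have "r \<bullet> r \<le> 0"
  proof (rule ccontr)
    assume "\<not> r \<bullet> r \<le> 0"
    then have pos: "r \<bullet> r > 0" by linarith
    define K where "K = \<bar>?f r - c * (r \<bullet> r)\<bar> + 1"
    have K: "K > 0" "?f r - c * (r \<bullet> r) \<ge> - K" by (auto simp: K_def)
    define t where "t = (r \<bullet> r) / K"
    have t: "t > 0" using pos K by (simp add: t_def)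
    have "t * (2 * (r \<bullet> r) + t * (?f r - c * (r \<bullet> r))) \<le> 0"
      using key[of t] by (simp add: power2_eq_square algebra_simps)
    then have "2 * (r \<bullet> r) + t * (?f r - c * (r \<bullet> r)) \<le> 0"
      using t by (simp add: mult_le_0_iff)
    moreover have "t * (?f r - c * (r \<bullet> r)) \<ge> t * (- K)"
      using K t by (intro mult_left_mono) auto
    moreover have "t * (- K) = - (r \<bullet> r)" using K by (simp add: t_def)
    ultimately show False using pos by linarith
  qed
  then have "r = 0" by (metis inner_gt_zero_iff not_le)
  then show ?thesis using that[of v c] v by (simp add: r_def)
qed

text \<open>
  The orthogonal complement of an eigenvector inside an invariant subspace is again
  invariant, because N is symmetric, and has smaller dimension.
\<close>

lemma orthonormal_eigenbasis_of_invariant_subspace: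
  fixes N :: "real^'n^'n"
  assumes sym: "transpose N = N"
  shows "subspace V \<Longrightarrow> (\<And>v. v \<in> V \<Longrightarrow> N *v v \<in> V) \<Longrightarrow>
    \<exists>B. finite B \<and> B \<subseteq> V \<and> card B = dim V \<and> pairwise orthogonal B \<and>
      (\<forall>b\<in>B. norm b = 1 \<and> (\<exists>c. N *v b = c *\<^sub>R b))"
proof (induction "dim V" arbitrary: V rule: less_induct)
  case less
  show ?case
  proof (cases "V = {0}")
    case True
    then show ?thesis by (intro exI[of _ "{}"]) auto
  next
    case False
    obtain v c where v: "v \<in> V" "norm v = 1" "N *v v = c *\<^sub>R v"
      using rayleigh_maximizer_eigenvector[OF sym less.prems False] .
    define W where "W = {y \<in> V. \<forall>x\<in>span {v}. orthogonal x y}"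
    have Wd: "W = {y \<in> V. v \<bullet> y = 0}"
      by (auto simp: W_def orthogonal_def span_singleton)
    have dimW: "dim W + 1 = dim V"
    proof -
      have "dim W + dim (span {v}) = dim V"
        unfolding W_def using less.prems v
        by (intro dim_subspace_orthogonal_to_vectors) (auto simp: span_minimal)
      moreover have "v \<noteq> 0" using v by auto
      ultimately show ?thesis by simp
    qed
    have subW: "subspace W" unfolding Wd using less.prems(1)
      by (auto simp: subspace_def inner_add_right)
    have invW: "N *v w \<in> W" if "w \<in> W" for w
      using that less.prems(2)[of w] v sym inner_matrix_vector_mult[of v N w] by (simp add: Wd)
    obtain B where B: "finite B" "B \<subseteq> W" "card B = dim W" "pairwise orthogonal B"
      "\<forall>b\<in>B. norm b = 1 \<and> (\<exists>c. N *v b = c *\<^sub>R b)"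
      using less.hyps[OF _ subW invW] dimW by auto
    have "v \<notin> B" using B(2) v by (auto simp: Wd norm_eq_1)
    then show ?thesis
      using B v dimW less.prems
      by (intro exI[of _ "insert v B"])
         (auto simp: pairwise_insert Wd orthogonal_def inner_commute subset_iff)
  qed
qed

definition diag_matrix :: "('n \<Rightarrow> real) \<Rightarrow> real^'n^'n" where
  "diag_matrix d = (\<chi> i j. if i = j then d i else 0)"

lemma diag_matrix_mult: "diag_matrix a ** diag_matrix b = diag_matrix (\<lambda>i. a i * b i)"
  by (simp add: diag_matrix_def matrix_matrix_mult_def vec_eq_iff mult_delta_left mult_delta_right)

lemma transpose_diag_matrix [simp]: "transpose (diag_matrix d) = diag_matrix d"
  by (auto simp: diag_matrix_def transpose_def vec_eq_iff)

lemma diag_matrix_congruence_nth: "(diag_matrix a ** X ** diag_matrix b) $ i $ j = a i * X $ i $ j * b j"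
  by (simp add: diag_matrix_def matrix_matrix_mult_def mult_delta_left mult_delta_right)

lemma det_diag_matrix: "det (diag_matrix d) = (\<Prod>i\<in>UNIV. d i)"
  by (subst det_diagonal) (auto simp: diag_matrix_def)

text \<open>
  The columns of Q are the vectors of an orthonormal eigenbasis, enumerated by the index type.
\<close>

theorem symmetric_matrix_diagonalization:
  fixes N :: "real^'n^'n"
  assumes sym: "transpose N = N"
  obtains Q d where "orthogonal_matrix Q" "N = Q ** diag_matrix d ** transpose Q"
proof -
  obtain B where B: "finite B" "card B = CARD('n)" "pairwise orthogonal B"
      "\<forall>b\<in>B. norm b = 1 \<and> (\<exists>c. N *v b = c *\<^sub>R b)"
    using orthonormal_eigenbasis_of_invariant_subspace[OF sym, of UNIV] by auto
  obtain f :: "'n \<Rightarrow> real^'n" where f: "bij_betw f UNIV B"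
    using B finite_same_card_bij[of "UNIV::'n set" B] by auto
  have fB: "f i \<in> B" for i using f by (auto simp: bij_betw_def)
  have "\<forall>i. \<exists>c. N *v f i = c *\<^sub>R f i" using bspec[OF B(4) fB] by simp
  then obtain d where d: "\<And>i. N *v f i = d i *\<^sub>R f i" by metis
  define Q where "Q = (\<chi> i j. f j $ i)"
  have col: "column i Q = f i" for i by (simp add: Q_def column_def)
  have "orthogonal (f i) (f j)" if "i \<noteq> j" for i j
  proof -
    have "f i \<noteq> f j" using f that by (auto simp: bij_betw_def dest: injD)
    then show ?thesis by (intro pairwiseD[OF B(3)] fB)
  qed
  then have Q: "orthogonal_matrix Q"
    unfolding orthogonal_matrix_orthonormal_columns col using bspec[OF B(4) fB] by simp
  have "N ** Q = Q ** diag_matrix d"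
  proof -
    have "(N ** Q) $ i $ j = (N *v f j) $ i" for i j
      by (simp add: matrix_matrix_mult_def matrix_vector_mult_def Q_def)
    then show ?thesis
      by (simp add: vec_eq_iff d) (simp add: matrix_matrix_mult_def diag_matrix_def Q_def mult_delta_left mult_delta_right)
  qed
  then have "N ** (Q ** transpose Q) = Q ** diag_matrix d ** transpose Q"
    by (simp add: matrix_mul_assoc)
  with Q that show ?thesis by (simp add: orthogonal_matrix_def)
qed

lemma matrix_inv_inverse:
  fixes A :: "real^'n^'n"
  assumes "invertible A"
  shows "A ** matrix_inv A = mat 1" "matrix_inv A ** A = mat 1"
  using someI_ex[OF assms[unfolded invertible_def]] by (auto simp: matrix_inv_def)

lemma matrix_inv_eqI:
  fixes A :: "real^'n^'n"
  assumes "A ** B = mat 1"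
  shows "matrix_inv A = B"
proof -
  have "invertible A" using assms invertible_right_inverse by blast
  then have "matrix_inv A ** (A ** B) = B" by (simp add: matrix_mul_assoc matrix_inv_inverse)
  then show ?thesis using assms by simp
qed

lemma spd_symmetric: "X \<in> spd \<Longrightarrow> transpose X = X"
  by (simp add: spd_def)

lemma spd_pos: "X \<in> spd \<Longrightarrow> v \<noteq> 0 \<Longrightarrow> 0 < v \<bullet> (X *v v)"
  by (simp add: spd_def)

lemma spd_invertible:
  assumes "X \<in> spd" shows "invertible X"
proof -
  have "\<forall>v. X *v v = 0 \<longrightarrow> v = 0" using spd_pos[OF assms] by force
  then show ?thesis by (simp add: matrix_left_invertible_ker invertible_left_inverse)
qed

lemma inner_congruence:
  fixes G X :: "real^'n^'n"
  shows "v \<bullet> ((G ** X ** transpose G) *v v) = (transpose G *v v) \<bullet> (X *v (transpose G *v v))"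
  by (simp add: inner_matrix_vector_mult[of v G] flip: matrix_vector_mul_assoc)

lemma transpose_congruence:
  fixes G X :: "real^'n^'n"
  shows "transpose (G ** X ** transpose G) = G ** transpose X ** transpose G"
  by (simp add: matrix_transpose_mul matrix_mul_assoc)

lemma spd_congruence:
  fixes G X :: "real^'n^'n"
  assumes G: "invertible G" and X: "X \<in> spd"
  shows "G ** X ** transpose G \<in> spd"
proof -
  have "transpose G *v v \<noteq> 0" if "v \<noteq> 0" for v
    by (metis G that invertible_left_inverse matrix_left_invertible_ker transpose_invertible)
  then show ?thesis using X spd_pos[OF X]
    by (simp add: spd_def inner_congruence transpose_congruence)
qed

lemma congruence_inverse:
  fixes G X :: "real^'n^'n"
  assumes G: "invertible G"
  shows "matrix_inv G ** (G ** X ** transpose G) ** transpose (matrix_inv G) = X"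
proof -
  have "transpose G ** transpose (matrix_inv G) = mat 1"
    by (simp add: G matrix_inv_inverse flip: matrix_transpose_mul)
  then have "X ** transpose G ** transpose (matrix_inv G) = X"
    by (simp flip: matrix_mul_assoc)
  then show ?thesis by (simp add: G matrix_inv_inverse matrix_mul_assoc)
qed

lemma invertible_matrix_inv:
  fixes G :: "real^'n^'n"
  shows "invertible G \<Longrightarrow> invertible (matrix_inv G)"
  using matrix_inv_inverse invertible_def by blast

lemma spd_congruence_iff:
  fixes G X :: "real^'n^'n"
  assumes G: "invertible G"
  shows "G ** X ** transpose G \<in> spd \<longleftrightarrow> X \<in> spd"
  by (metis G congruence_inverse invertible_matrix_inv spd_congruence)

lemma spd_diag_matrix:
  fixes d :: "'n::finite \<Rightarrow> real"
  shows "diag_matrix d \<in> spd \<longleftrightarrow> (\<forall>i. 0 < d i)"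
proof
  assume "diag_matrix d \<in> spd"
  from spd_pos[OF this, of "axis i 1" for i] show "\<forall>i. 0 < d i"
    by (simp add: inner_axis' matrix_vector_mul_component diag_matrix_def inner_axis axis_eq_0_iff)
next
  assume d: "\<forall>i. 0 < d i"
  have "v \<bullet> (diag_matrix d *v v) = (\<Sum>i\<in>UNIV. d i * (v $ i)\<^sup>2)" for v :: "real^'n"
    by (simp add: inner_vec_def diag_matrix_def matrix_vector_mult_def mult_delta_left
        mult_delta_right power2_eq_square mult_ac)
  moreover have "0 < (\<Sum>i\<in>UNIV. d i * (v $ i)\<^sup>2)" if v: "v \<noteq> 0" for v :: "real^'n"
  proof -
    obtain i where "v $ i \<noteq> 0" using v by (auto simp: vec_eq_iff)
    then show ?thesis using d by (intro sum_pos2[of _ i]) (auto simp: less_imp_le)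
  qed
  ultimately show "diag_matrix d \<in> spd" by (simp add: spd_def)
qed

lemma orthogonal_matrix_invertible: "orthogonal_matrix Q \<Longrightarrow> invertible (Q :: real^'n^'n)"
  unfolding orthogonal_matrix_def invertible_def by blast

lemma spd_diagonalization:
  fixes X :: "real^'n^'n"
  assumes "X \<in> spd"
  obtains Q d where "orthogonal_matrix Q" "X = Q ** diag_matrix d ** transpose Q" "\<forall>i. 0 < d i"
proof -
  obtain Q d where Q: "orthogonal_matrix Q" and X: "X = Q ** diag_matrix d ** transpose Q"
    by (rule symmetric_matrix_diagonalization[OF spd_symmetric[OF assms]])
  have "diag_matrix d \<in> spd"
    using assms unfolding X spd_congruence_iff[OF orthogonal_matrix_invertible[OF Q]] .
  then have "\<forall>i. 0 < d i" by (simp add: spd_diag_matrix)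
  with Q X show ?thesis by (rule that)
qed

lemma spd_sqrt_exists:
  assumes "X \<in> spd"
  obtains Y where "Y \<in> spd" "Y ** Y = X"
proof -
  obtain Q d where Q: "orthogonal_matrix Q" and X: "X = Q ** diag_matrix d ** transpose Q"
    and d: "\<forall>i. 0 < d i" by (rule spd_diagonalization[OF assms])
  define Y where "Y = Q ** diag_matrix (\<lambda>i. sqrt (d i)) ** transpose Q"
  have "Y ** Y = Q ** diag_matrix (\<lambda>i. sqrt (d i)) ** (transpose Q ** Q) **
      diag_matrix (\<lambda>i. sqrt (d i)) ** transpose Q"
    by (simp add: Y_def matrix_mul_assoc)
  also have "\<dots> = Q ** (diag_matrix (\<lambda>i. sqrt (d i)) ** diag_matrix (\<lambda>i. sqrt (d i))) ** transpose Q"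
    using Q by (simp add: orthogonal_matrix_def matrix_mul_assoc)
  also have "\<dots> = X" using d by (simp add: diag_matrix_mult X less_imp_le)
  finally have sq: "Y ** Y = X" .
  have "Y \<in> spd"
    unfolding Y_def by (intro spd_congruence orthogonal_matrix_invertible Q) (simp add: spd_diag_matrix d)
  from this sq show ?thesis by (rule that)
qed

lemma trace_congruence_spd:
  fixes D Y :: "real^'n^'n"
  assumes Y: "Y \<in> spd"
  shows "0 \<le> trace (transpose D ** Y ** D)" "trace (transpose D ** Y ** D) = 0 \<Longrightarrow> D = 0"
proof -
  have e: "(transpose D ** Y ** D) $ i $ i = column i D \<bullet> (Y *v column i D)" for i
    unfolding matrix_mul_assoc[symmetric]
    by (simp add: matrix_matrix_mult_def transpose_def inner_vec_def matrix_vector_mult_def column_def)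
  have nn: "0 \<le> (transpose D ** Y ** D) $ i $ i" for i
    unfolding e using spd_pos[OF Y, of "column i D"] by (cases "column i D = 0") auto
  then show "0 \<le> trace (transpose D ** Y ** D)" by (simp add: trace_def sum_nonneg)
  assume "trace (transpose D ** Y ** D) = 0"
  then have "(transpose D ** Y ** D) $ i $ i = 0" for i
    using nn by (simp add: trace_def sum_nonneg_eq_0_iff)
  then have "column i D = 0" for i
    using spd_pos[OF Y, of "column i D"] by (cases "column i D = 0") (auto simp: e)
  then show "D = 0" by (simp add: column_def vec_eq_iff)
qed

text \<open>
  With D = Y - Z, equality of the squares reads Y D + D Z = 0. Multiplying by D and taking the
  trace gives tr (D Y D) + tr (D Z D) = 0, a sum of two nonnegative terms, the first of which
  vanishes only for D = 0.
\<close>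

lemma spd_sqrt_unique:
  fixes Y Z :: "real^'n^'n"
  assumes Y: "Y \<in> spd" and Z: "Z \<in> spd" and eq: "Y ** Y = Z ** Z"
  shows "Y = Z"
proof -
  define D where "D = Y - Z"
  have D: "transpose D = D" using Y Z by (simp add: D_def spd_def transpose_def vec_eq_iff)
  have "Y ** Y = Y ** (Z + D)" by (simp add: D_def)
  also have "\<dots> = Y ** Z + Y ** D" by (rule matrix_add_ldistrib)
  also have "Y ** Z = (Z + D) ** Z" by (simp add: D_def)
  also have "\<dots> + Y ** D = Z ** Z + (Y ** D + D ** Z)" 
    by (simp add: matrix_matrix_mult_def vec_eq_iff distrib_right sum.distrib)
  finally have "Y ** D + D ** Z = 0" using eq by simp
  then have "D ** (Y ** D + D ** Z) = 0" by simp
  then have "trace (D ** Y ** D) + trace (D ** D ** Z) = 0"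
    by (metis matrix_add_ldistrib matrix_mul_assoc trace_0 trace_add mat_0)
  moreover have "trace (D ** D ** Z) = trace (D ** Z ** D)"
    by (metis matrix_mul_assoc trace_mul_sym)
  moreover have "0 \<le> trace (D ** Y ** D)" "0 \<le> trace (D ** Z ** D)"
    using trace_congruence_spd(1)[OF Y, of D] trace_congruence_spd(1)[OF Z, of D] D by auto
  ultimately have "trace (transpose D ** Y ** D) = 0" using D by simp
  then have "D = 0" by (rule trace_congruence_spd(2)[OF Y])
  then show ?thesis by (simp add: D_def)
qed

text \<open>
  By existence and uniqueness of the root, the definite description in the definition of
  \<open>spd_sqrt\<close> denotes it.
\<close>

lemma spd_sqrt:
  assumes "X \<in> spd"
  shows "spd_sqrt X \<in> spd" "spd_sqrt X ** spd_sqrt X = X"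
proof -
  obtain Y where Y: "Y \<in> spd" "Y ** Y = X" by (rule spd_sqrt_exists[OF assms])
  have "spd_sqrt X = Y"
    unfolding spd_sqrt_def using Y by (intro the_equality) (auto intro: spd_sqrt_unique)
  with Y show "spd_sqrt X \<in> spd" "spd_sqrt X ** spd_sqrt X = X" by auto
qed

lemma transpose_matrix_inv:
  fixes G :: "real^'n^'n"
  assumes "invertible G"
  shows "transpose (matrix_inv G) = matrix_inv (transpose G)"
  by (rule matrix_inv_eqI[symmetric]) (simp add: assms matrix_inv_inverse flip: matrix_transpose_mul)

lemma spd_matrix_inv:
  assumes X: "X \<in> spd" shows "matrix_inv X \<in> spd"
proof -
  have i: "invertible X" using X by (rule spd_invertible)
  have "matrix_inv X ** X ** transpose (matrix_inv X) = matrix_inv X"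
    by (simp add: transpose_matrix_inv i spd_symmetric[OF X] matrix_inv_inverse)
  then show ?thesis using spd_congruence[OF invertible_matrix_inv[OF i] X] by simp
qed

lemma spd_det_pos:
  assumes X: "X \<in> spd" shows "0 < det X"
proof -
  have "det X = (det (spd_sqrt X))\<^sup>2"
    using spd_sqrt(2)[OF X] by (metis det_mul power2_eq_square)
  moreover have "det (spd_sqrt X) \<noteq> 0"
    using spd_sqrt(1)[OF X] spd_invertible invertible_det_nz by blast
  ultimately show ?thesis by simp
qed

lemma norm_matrix_squared:
  fixes X :: "real^'n^'m"
  shows "(norm X)\<^sup>2 = (\<Sum>i\<in>UNIV. \<Sum>j\<in>UNIV. (X $ i $ j)\<^sup>2)"
  unfolding power2_norm_eq_inner by (simp add: inner_vec_def power2_eq_square)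

lemma norm_matrix_squared_trace:
  fixes X :: "real^'n^'n"
  shows "(norm X)\<^sup>2 = trace (transpose X ** X)"
  unfolding norm_matrix_squared
  by (subst sum.swap) (simp add: trace_def matrix_matrix_mult_def transpose_def power2_eq_square)

section \<open>Linear substitutions in products of Lebesgue measure\<close>

interpretation lborel_product: product_sigma_finite "\<lambda>_::'i. lborel :: real measure"
  by standard

text \<open>
  Change of variables for a coordinatewise affine map. It gives both the scaling by diagonal
  matrices and, with all factors equal to 1, translations.
\<close>

lemma nn_integral_PiM_lborel_affine:
  fixes f :: "('i \<Rightarrow> real) \<Rightarrow> ennreal" and a c :: "'i \<Rightarrow> real"
  assumes "finite I" "\<And>i. i \<in> I \<Longrightarrow> c i \<noteq> 0"
    and "f \<in> borel_measurable (\<Pi>\<^sub>M i\<in>I. lborel)"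
  shows "(\<integral>\<^sup>+x. f x \<partial>(\<Pi>\<^sub>M i\<in>I. lborel)) =
    ennreal (\<Prod>i\<in>I. \<bar>c i\<bar>) * (\<integral>\<^sup>+x. f (\<lambda>i\<in>I. a i + c i * x i) \<partial>(\<Pi>\<^sub>M i\<in>I. lborel))"
  using assms
proof (induction I arbitrary: f rule: finite_induct)
  case empty
  have "(\<lambda>i\<in>{}. a i + c i * x i) = (\<lambda>_. undefined)" for x :: "'i \<Rightarrow> real" by auto
  then show ?case
    by (simp add: PiM_empty nn_integral_count_space_finite)
next
  case (insert i I)
  note [measurable] = insert.prems(2)
  define g where "g x = (\<integral>\<^sup>+y. f (x(i := y)) \<partial>lborel)" for x
  have [measurable]: "g \<in> borel_measurable (\<Pi>\<^sub>M i\<in>I. lborel)"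
    unfolding g_def by measurable
  have aff: "(\<lambda>x. \<lambda>j\<in>insert i I. a j + c j * x j) \<in>
      (\<Pi>\<^sub>M i\<in>insert i I. lborel) \<rightarrow>\<^sub>M (\<Pi>\<^sub>M i\<in>insert i I. lborel)"
    by measurable
  have fm: "(\<lambda>x. f (\<lambda>j\<in>insert i I. a j + c j * x j)) \<in> borel_measurable (\<Pi>\<^sub>M i\<in>insert i I. lborel)"
    by (rule measurable_compose[OF aff insert.prems(2)])
  have affI[measurable]: "(\<lambda>x. \<lambda>j\<in>I. a j + c j * x j) \<in>
      (\<Pi>\<^sub>M i\<in>I. lborel) \<rightarrow>\<^sub>M (\<Pi>\<^sub>M i\<in>I. lborel)"
    by measurable
  have g_aff: "g (\<lambda>j\<in>I. a j + c j * x j) =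
      \<bar>c i\<bar> * (\<integral>\<^sup>+y. f (\<lambda>j\<in>insert i I. a j + c j * (x(i := y)) j) \<partial>lborel)"
    if x: "x \<in> space (\<Pi>\<^sub>M i\<in>I. lborel)" for x
  proof -
    have "(\<lambda>y. f ((\<lambda>j\<in>I. a j + c j * x j)(i := y))) \<in> borel_measurable borel"
    proof -
      have "(\<lambda>j\<in>I. a j + c j * x j) \<in> space (\<Pi>\<^sub>M i\<in>I. lborel)" by (simp add: space_PiM)
      from measurable_compose[OF measurable_component_update[OF this insert.hyps(2)] insert.prems(2)]
      show ?thesis by simp
    qed
    from nn_integral_real_affine[OF this, of "c i" "a i"] insert.prems(1)[of i]
    have "g (\<lambda>j\<in>I. a j + c j * x j) =
        \<bar>c i\<bar> * (\<integral>\<^sup>+y. f ((\<lambda>j\<in>I. a j + c j * x j)(i := a i + c i * y)) \<partial>lborel)"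
      by (simp add: g_def)
    moreover have "(\<lambda>j\<in>I. a j + c j * x j)(i := a i + c i * y) =
        (\<lambda>j\<in>insert i I. a j + c j * (x(i := y)) j)" for y
      using insert.hyps by (auto simp: fun_eq_iff)
    ultimately show ?thesis by simp
  qed
  have "(\<integral>\<^sup>+x. f x \<partial>(\<Pi>\<^sub>M i\<in>insert i I. lborel)) = (\<integral>\<^sup>+x. g x \<partial>(\<Pi>\<^sub>M i\<in>I. lborel))"
    using insert by (simp add: lborel_product.product_nn_integral_insert g_def)
  also have "\<dots> = ennreal (\<Prod>i\<in>I. \<bar>c i\<bar>) *
      (\<integral>\<^sup>+x. g (\<lambda>j\<in>I. a j + c j * x j) \<partial>(\<Pi>\<^sub>M i\<in>I. lborel))"
    using insert.prems by (intro insert.IH) auto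
  also have "(\<integral>\<^sup>+x. g (\<lambda>j\<in>I. a j + c j * x j) \<partial>(\<Pi>\<^sub>M i\<in>I. lborel)) =
     (\<integral>\<^sup>+x. \<bar>c i\<bar> * (\<integral>\<^sup>+y. f (\<lambda>j\<in>insert i I. a j + c j * (x(i := y)) j) \<partial>lborel) \<partial>(\<Pi>\<^sub>M i\<in>I. lborel))"
    by (intro nn_integral_cong g_aff)
  also have "\<dots> = \<bar>c i\<bar> * (\<integral>\<^sup>+x. (\<integral>\<^sup>+y. f (\<lambda>j\<in>insert i I. a j + c j * (x(i := y)) j) \<partial>lborel) \<partial>(\<Pi>\<^sub>M i\<in>I. lborel))"
  proof (rule nn_integral_cmult)
    note [measurable] = fm
    show "(\<lambda>x. \<integral>\<^sup>+y. f (\<lambda>j\<in>insert i I. a j + c j * (x(i := y)) j) \<partial>lborel) \<in> borel_measurable (\<Pi>\<^sub>M i\<in>I. lborel)"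
      by measurable
  qed
  also have "\<dots> = \<bar>c i\<bar> * (\<integral>\<^sup>+x. f (\<lambda>j\<in>insert i I. a j + c j * x j) \<partial>(\<Pi>\<^sub>M i\<in>insert i I. lborel))"
    using insert.hyps fm by (subst lborel_product.product_nn_integral_insert) auto
  finally show ?case
    unfolding mult.assoc[symmetric] prod.insert[OF insert.hyps]
    by (simp only: ennreal_mult'' prod_nonneg abs_ge_zero mult.commute)
qed

lemma nn_integral_PiM_lborel_involution:
  fixes f :: "('i \<Rightarrow> real) \<Rightarrow> ennreal"
  assumes I: "finite I" and \<sigma>: "\<And>i. i \<in> I \<Longrightarrow> \<sigma> i \<in> I" "\<And>i. i \<in> I \<Longrightarrow> \<sigma> (\<sigma> i) = i"
    and f: "f \<in> borel_measurable (\<Pi>\<^sub>M i\<in>I. lborel)"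
  shows "(\<integral>\<^sup>+x. f (\<lambda>i\<in>I. x (\<sigma> i)) \<partial>(\<Pi>\<^sub>M i\<in>I. lborel)) = (\<integral>\<^sup>+x. f x \<partial>(\<Pi>\<^sub>M i\<in>I. lborel))"
proof -
  let ?P = "\<Pi>\<^sub>M i\<in>I. (lborel :: real measure)"
  have m: "(\<lambda>x. \<lambda>i\<in>I. x (\<sigma> i)) \<in> ?P \<rightarrow>\<^sub>M ?P"
    using \<sigma> by (intro measurable_restrict measurable_component_singleton) auto
  have "distr ?P ?P (\<lambda>x. \<lambda>i\<in>I. x (\<sigma> i)) = ?P"
  proof (rule lborel_product.PiM_eqI[OF I])
    fix A :: "'i \<Rightarrow> real set" assume A: "\<And>i. i \<in> I \<Longrightarrow> A i \<in> sets lborel"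
    have "(\<lambda>x. \<lambda>i\<in>I. x (\<sigma> i)) -` Pi\<^sub>E I A \<inter> space ?P = Pi\<^sub>E I (\<lambda>i. A (\<sigma> i))"
      using \<sigma> by (auto simp: space_PiM PiE_iff extensional_def; metis)
    moreover have "Pi\<^sub>E I A \<in> sets ?P" using A I by (intro sets_PiM_I_finite) auto
    ultimately have "emeasure (distr ?P ?P (\<lambda>x. \<lambda>i\<in>I. x (\<sigma> i))) (Pi\<^sub>E I A) = emeasure ?P (Pi\<^sub>E I (\<lambda>i. A (\<sigma> i)))"
      using m by (simp add: emeasure_distr)
    also have "\<dots> = (\<Prod>i\<in>I. emeasure lborel (A (\<sigma> i)))"
      using A \<sigma> I by (intro lborel_product.emeasure_PiM) auto
    also have "\<dots> = (\<Prod>i\<in>I. emeasure lborel (A i))"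
      using \<sigma> by (intro prod.reindex_bij_witness[of _ \<sigma> \<sigma>]) auto
    finally show "emeasure (distr ?P ?P (\<lambda>x. \<lambda>i\<in>I. x (\<sigma> i))) (Pi\<^sub>E I A) = (\<Prod>i\<in>I. emeasure lborel (A i))" .
  qed simp
  then have "(\<integral>\<^sup>+x. f x \<partial>?P) = (\<integral>\<^sup>+x. f x \<partial>distr ?P ?P (\<lambda>x. \<lambda>i\<in>I. x (\<sigma> i)))" by simp
  also have "\<dots> = (\<integral>\<^sup>+x. f (\<lambda>i\<in>I. x (\<sigma> i)) \<partial>?P)" using m f by (subst nn_integral_distr) simp_all
  finally show ?thesis by simp
qed

text \<open>
  Fubini: with the coordinates outside J held fixed, the map translates the coordinates in J by
  a constant vector. The two places where off-diagonal structure enters, transvections and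
  Schur complements, are both of this kind.
\<close>

lemma nn_integral_PiM_lborel_shear:
  fixes f :: "('i \<Rightarrow> real) \<Rightarrow> ennreal" and g :: "('i \<Rightarrow> real) \<Rightarrow> 'i \<Rightarrow> real"
  assumes K: "finite K" and J: "J \<subseteq> K"
    and g: "\<And>e. e \<in> J \<Longrightarrow> (\<lambda>x. g x e) \<in> borel_measurable (\<Pi>\<^sub>M i\<in>K. lborel)"
    and dep: "\<And>x y e. e \<in> J \<Longrightarrow> (\<And>i. i \<in> K - J \<Longrightarrow> x i = y i) \<Longrightarrow> g x e = g y e"
    and f: "f \<in> borel_measurable (\<Pi>\<^sub>M i\<in>K. lborel)"
  shows "(\<integral>\<^sup>+x. f x \<partial>(\<Pi>\<^sub>M i\<in>K. lborel)) =
    (\<integral>\<^sup>+x. f (\<lambda>e\<in>K. if e \<in> J then x e + g x e else x e) \<partial>(\<Pi>\<^sub>M i\<in>K. lborel))"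
proof -
  define I where "I = K - J"
  have IJ: "I \<inter> J = {}" "finite I" "finite J" and KIJ: "K = I \<union> J"
    using K J by (auto simp: I_def intro: finite_subset)
  let ?P = "\<lambda>I. \<Pi>\<^sub>M i\<in>I. (lborel :: real measure)"
  define sh where "sh x = (\<lambda>e\<in>K. if e \<in> J then x e + g x e else x e)" for x
  have "(\<lambda>x. if e \<in> J then x e + g x e else x e) \<in> borel_measurable (?P K)" if "e \<in> K" for e
    using g[of e] that by (cases "e \<in> J") simp_all
  then have sh[measurable]: "sh \<in> ?P K \<rightarrow>\<^sub>M ?P K"
    unfolding sh_def by (intro measurable_restrict) simp
  note f[measurable]
  have inner: "(\<integral>\<^sup>+y. f (merge I J (x, y)) \<partial>?P J) = (\<integral>\<^sup>+y. f (sh (merge I J (x, y))) \<partial>?P J)"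
    if x: "x \<in> space (?P I)" for x
  proof -
    define a where "a = g x"
    have gx: "g (merge I J (x, y)) e = a e" if "e \<in> J" for e y
      unfolding a_def using that IJ by (intro dep) (auto simp: KIJ)
    have sh_merge: "sh (merge I J (x, y)) = merge I J (x, \<lambda>j\<in>J. a j + 1 * y j)" for y
      using IJ x gx by (auto simp: sh_def fun_eq_iff KIJ merge_def space_PiM PiE_iff extensional_def)
    have "(\<lambda>y. f (merge I J (x, y))) \<in> borel_measurable (?P J)"
    proof (rule measurable_compose[where g = f])
      show "(\<lambda>y. merge I J (x, y)) \<in> ?P J \<rightarrow>\<^sub>M ?P K"
        unfolding KIJ using x by measurable
    qed fact
    from nn_integral_PiM_lborel_affine[OF IJ(3) _ this, of "\<lambda>_. 1" a]
    show ?thesis by (simp add: sh_merge)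
  qed
  have fsh: "(\<lambda>x. f (sh x)) \<in> borel_measurable (?P (I \<union> J))"
    unfolding KIJ[symmetric] by measurable
  have "(\<integral>\<^sup>+x. f x \<partial>?P K) = (\<integral>\<^sup>+x. (\<integral>\<^sup>+y. f (merge I J (x, y)) \<partial>?P J) \<partial>?P I)"
    using lborel_product.product_nn_integral_fold[OF IJ, of f] f by (simp add: KIJ)
  also have "\<dots> = (\<integral>\<^sup>+x. (\<integral>\<^sup>+y. f (sh (merge I J (x, y))) \<partial>?P J) \<partial>?P I)"
    by (intro nn_integral_cong inner)
  also have "\<dots> = (\<integral>\<^sup>+x. f (sh x) \<partial>?P K)"
    using lborel_product.product_nn_integral_fold[OF IJ fsh] by (simp add: KIJ)
  finally show ?thesis by (simp add: sh_def)
qed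

section \<open>The Jacobian of a congruence on symmetric matrices\<close>

text \<open>
  The coordinates of a symmetric matrix with rows and columns in I, one for each unordered
  pair; a diagonal position gives a singleton.
\<close>

definition edges :: "'n set \<Rightarrow> 'n set set" where
  "edges I = (\<lambda>(i, j). {i, j}) ` (I \<times> I)"

lemma edges_iff: "e \<in> edges I \<longleftrightarrow> (\<exists>i\<in>I. \<exists>j\<in>I. e = {i, j})"
  by (auto simp: edges_def)

lemma finite_edges [simp]: "finite I \<Longrightarrow> finite (edges I)"
  by (simp add: edges_def)

text \<open>
  The product over the two endpoints of e. The exponent counts the single element of a loop
  {i} twice, so that {i, j} receives the weight a i * a j also when i = j.
\<close>

definition edge_weight :: "('n \<Rightarrow> real) \<Rightarrow> 'n set \<Rightarrow> real" where
  "edge_weight a e = (\<Prod>i\<in>e. a i ^ (3 - card e))"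

lemma edge_weight_pair [simp]: "edge_weight a {i, j} = a i * a j"
  by (cases "i = j") (simp_all add: edge_weight_def power2_eq_square)

lemma edge_weight_singleton [simp]: "edge_weight a {i} = a i * a i"
  using edge_weight_pair[of a i i] by simp

text \<open>
  Exchanging the products, a fixed i occurs twice in {i} and once in each of the other
  CARD('n) - 1 pairs that contain it. This is the exponent in the Jacobian of a congruence.
\<close>

lemma prod_edge_weight:
  fixes a :: "'n::finite \<Rightarrow> real"
  shows "(\<Prod>e\<in>edges UNIV. edge_weight a e) = (\<Prod>i\<in>UNIV. a i) ^ (CARD('n) + 1)"
proof -
  have "(\<Prod>e\<in>edges UNIV. edge_weight a e) =
      (\<Prod>e\<in>edges UNIV. \<Prod>i\<in>UNIV. if i \<in> e then a i ^ (3 - card e) else 1)"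
    by (simp add: edge_weight_def prod.If_cases)
  also have "\<dots> = (\<Prod>i\<in>UNIV. \<Prod>e\<in>edges UNIV. if i \<in> e then a i ^ (3 - card e) else 1)"
    by (rule prod.swap)
  also have "\<dots> = (\<Prod>i\<in>UNIV. a i ^ (CARD('n) + 1))"
  proof (rule prod.cong[OF refl])
    fix i :: 'n
    have inj: "inj_on (\<lambda>j. {i, j}) (UNIV - {i})" by (auto simp: inj_on_def doubleton_eq_iff)
    have E: "edges UNIV \<inter> {e. i \<in> e} = insert {i} ((\<lambda>j. {i, j}) ` (UNIV - {i}))"
      by (auto simp: edges_iff; blast)
    have "(\<Prod>e\<in>edges UNIV. if i \<in> e then a i ^ (3 - card e) else 1) =
        (\<Prod>e\<in>insert {i} ((\<lambda>j. {i, j}) ` (UNIV - {i})). a i ^ (3 - card e))"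
      by (simp add: prod.If_cases E)
    also have "\<dots> = (a i)\<^sup>2 * (\<Prod>j\<in>UNIV - {i}. a i ^ (3 - card {i, j}))"
      by (subst prod.insert) (auto simp: prod.reindex[OF inj] doubleton_eq_iff)
    also have "(\<Prod>j\<in>UNIV - {i}. a i ^ (3 - card {i, j})) = (\<Prod>j\<in>UNIV - {i}. a i)"
      by (intro prod.cong) auto
    also have "(a i)\<^sup>2 * \<dots> = a i ^ (2 + (CARD('n) - 1))" by (simp only: prod_constant card_Diff_singleton[OF UNIV_I] power_add)
    also have "2 + (CARD('n) - 1) = CARD('n) + 1" using zero_less_card_finite[where 'a='n] by linarith
    finally show "(\<Prod>e\<in>edges UNIV. if i \<in> e then a i ^ (3 - card e) else 1) = a i ^ (CARD('n) + 1)" .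
  qed
  finally show ?thesis by (simp only: prod_power_distrib)
qed

lemma borel_measurable_matrix:
  fixes F :: "'a \<Rightarrow> real^'n^'m"
  assumes "\<And>i j. (\<lambda>x. F x $ i $ j) \<in> borel_measurable M"
  shows "F \<in> borel_measurable M"
  using assms
  by (subst borel_measurable_euclidean_space) (auto simp: Basis_vec_def inner_axis)

lemma borel_measurable_matrix_nth [measurable]: "(\<lambda>X::real^'n^'m. X $ i $ j) \<in> borel_measurable borel"
  by (intro borel_measurable_continuous_onI continuous_intros)

lemma borel_measurable_matrix_mult [measurable]:
  fixes F :: "'a \<Rightarrow> real^'n^'m" and G :: "'a \<Rightarrow> real^'k^'n"
  assumes [measurable]: "F \<in> borel_measurable M" "G \<in> borel_measurable M"
  shows "(\<lambda>x. F x ** G x) \<in> borel_measurable M"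
  by (rule borel_measurable_matrix) (simp add: matrix_matrix_mult_def)

lemma borel_measurable_det [measurable]: "(det :: real^'n^'n \<Rightarrow> real) \<in> borel_measurable borel"
  unfolding det_def by measurable

lemma borel_measurable_trace [measurable]: "(trace :: real^'n^'n \<Rightarrow> real) \<in> borel_measurable borel"
  unfolding trace_def by measurable

abbreviation sym_lebesgue :: "(real^'n^'n) measure" where
  "sym_lebesgue \<equiv> distr (\<Pi>\<^sub>M e\<in>edges (UNIV :: 'n set). lborel) borel sym_of_coords"

lemma sym_of_coords_nth [simp]: "sym_of_coords x $ i $ j = x {i, j}"
  by (simp add: sym_of_coords_def)

lemma edges_UNIV_pair [simp]: "{i, j} \<in> edges UNIV"
  by (auto simp: edges_iff)

lemma edges_UNIV_singleton [simp]: "{i} \<in> edges UNIV"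
  by (auto simp: edges_iff)

lemma measurable_sym_of_coords [measurable]:
  "sym_of_coords \<in> (\<Pi>\<^sub>M e\<in>edges (UNIV::'n::finite set). lborel) \<rightarrow>\<^sub>M borel"
proof (rule borel_measurable_matrix)
  fix i j :: 'n
  have "(\<lambda>x. x {i, j}) \<in> borel_measurable (\<Pi>\<^sub>M e\<in>edges (UNIV::'n::finite set). (lborel :: real measure))"
    using measurable_component_singleton[of "{i, j}" "edges UNIV" "\<lambda>_. lborel :: real measure"] by simp
  then show "(\<lambda>x. sym_of_coords x $ i $ j) \<in> borel_measurable (\<Pi>\<^sub>M e\<in>edges (UNIV::'n::finite set). lborel)"
    by simp
qed

lemma nn_integral_sym_lebesgue:
  "f \<in> borel_measurable borel \<Longrightarrow>
   (\<integral>\<^sup>+X. f X \<partial>(sym_lebesgue :: (real^'n^'n) measure)) =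
   (\<integral>\<^sup>+x. f (sym_of_coords x) \<partial>(\<Pi>\<^sub>M e\<in>edges (UNIV :: 'n set). lborel))"
  by (rule nn_integral_distr) simp_all

text \<open>
  The change of variables formula for X \<mapsto> A X A^T. As a predicate on A it is closed under
  products, so it only has to be checked on elementary matrices.
\<close>

definition scales_sym_lebesgue :: "real^'n^'n \<Rightarrow> bool" where
  "scales_sym_lebesgue A \<longleftrightarrow> (\<forall>f \<in> borel_measurable borel.
     (\<integral>\<^sup>+X. f X \<partial>sym_lebesgue) =
     ennreal (\<bar>det A\<bar> ^ (CARD('n) + 1)) * (\<integral>\<^sup>+X. f (A ** X ** transpose A) \<partial>sym_lebesgue))"

lemma measurable_congruence [measurable]:
  fixes A :: "real^'n^'n"
  shows "(\<lambda>X. A ** X ** transpose A) \<in> borel_measurable borel"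
  by measurable

lemma scales_sym_lebesgue_mult:
  fixes A B :: "real^'n^'n"
  assumes "scales_sym_lebesgue A" "scales_sym_lebesgue B"
  shows "scales_sym_lebesgue (A ** B)"
  unfolding scales_sym_lebesgue_def
proof
  fix f :: "real^'n^'n \<Rightarrow> ennreal" assume f[measurable]: "f \<in> borel_measurable borel"
  have "(\<lambda>X. f (A ** X ** transpose A)) \<in> borel_measurable borel" by measurable
  note B = bspec[OF assms(2)[unfolded scales_sym_lebesgue_def] this]
  have "(\<integral>\<^sup>+X. f X \<partial>sym_lebesgue) =
    ennreal (\<bar>det A\<bar> ^ (CARD('n) + 1)) * (ennreal (\<bar>det B\<bar> ^ (CARD('n) + 1)) *
      (\<integral>\<^sup>+X. f (A ** (B ** X ** transpose B) ** transpose A) \<partial>sym_lebesgue))"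
    unfolding B[symmetric] using assms(1) f unfolding scales_sym_lebesgue_def by (rule bspec)
  then show "(\<integral>\<^sup>+X. f X \<partial>sym_lebesgue) = ennreal (\<bar>det (A ** B)\<bar> ^ (CARD('n) + 1)) *
      (\<integral>\<^sup>+X. f (A ** B ** X ** transpose (A ** B)) \<partial>sym_lebesgue)"
    by (simp add: det_mul abs_mult power_mult_distrib ennreal_mult'' matrix_transpose_mul matrix_mul_assoc mult_ac)
qed

text \<open>
  A diagonal congruence multiplies the coordinate {i, j} by a i * a j.
\<close>

lemma scales_sym_lebesgue_diag_matrix:
  fixes a :: "'n::finite \<Rightarrow> real"
  assumes a: "\<And>i. a i \<noteq> 0"
  shows "scales_sym_lebesgue (diag_matrix a)"
  unfolding scales_sym_lebesgue_def
proof
  fix f :: "real^'n^'n \<Rightarrow> ennreal" assume f[measurable]: "f \<in> borel_measurable borel"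
  let ?P = "\<Pi>\<^sub>M e\<in>edges (UNIV::'n set). (lborel :: real measure)"
  have nz: "edge_weight a e \<noteq> 0" if "e \<in> edges UNIV" for e using that a by (auto simp: edges_iff)
  have f': "(\<lambda>x. f (sym_of_coords x)) \<in> borel_measurable ?P" by measurable
  have eq: "sym_of_coords (\<lambda>e\<in>edges UNIV. 0 + edge_weight a e * x e) =
      diag_matrix a ** sym_of_coords x ** transpose (diag_matrix a)" for x
    by (simp add: vec_eq_iff diag_matrix_congruence_nth)
  have "(\<integral>\<^sup>+X. f X \<partial>sym_lebesgue) = (\<integral>\<^sup>+x. f (sym_of_coords x) \<partial>?P)"
    by (rule nn_integral_sym_lebesgue) simp
  also have "\<dots> = ennreal (\<Prod>e\<in>edges UNIV. \<bar>edge_weight a e\<bar>) *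
      (\<integral>\<^sup>+x. f (sym_of_coords (\<lambda>e\<in>edges UNIV. 0 + edge_weight a e * x e)) \<partial>?P)"
    by (rule nn_integral_PiM_lborel_affine[OF _ nz f']) simp
  also have "(\<Prod>e\<in>edges UNIV. \<bar>edge_weight a e\<bar>) = \<bar>det (diag_matrix a)\<bar> ^ (CARD('n) + 1)"
    by (simp only: abs_prod[symmetric] prod_edge_weight det_diag_matrix power_abs)
  also have "(\<integral>\<^sup>+x. f (sym_of_coords (\<lambda>e\<in>edges UNIV. 0 + edge_weight a e * x e)) \<partial>?P) =
      (\<integral>\<^sup>+X. f (diag_matrix a ** X ** transpose (diag_matrix a)) \<partial>sym_lebesgue)"
    unfolding eq by (rule nn_integral_sym_lebesgue[symmetric]) simp
  finally show "(\<integral>\<^sup>+X. f X \<partial>sym_lebesgue) = ennreal (\<bar>det (diag_matrix a)\<bar> ^ (CARD('n) + 1)) *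
      (\<integral>\<^sup>+X. f (diag_matrix a ** X ** transpose (diag_matrix a)) \<partial>sym_lebesgue)" .
qed

text \<open>
  A transposition of the index set permutes the coordinates.
\<close>

lemma scales_sym_lebesgue_swap:
  fixes m n :: "'n::finite"
  shows "scales_sym_lebesgue (\<chi> i j. mat 1 $ i $ Transposition.transpose m n j)" (is "scales_sym_lebesgue ?A")
  unfolding scales_sym_lebesgue_def
proof
  fix f :: "real^'n^'n \<Rightarrow> ennreal" assume f[measurable]: "f \<in> borel_measurable borel"
  let ?P = "\<Pi>\<^sub>M e\<in>edges (UNIV::'n set). (lborel :: real measure)"
  let ?t = "Transposition.transpose m n"
  have t: "i = ?t k \<longleftrightarrow> k = ?t i" for i k by auto
  have left: "(?A ** X) $ i $ j = X $ ?t i $ j" for X :: "real^'n^'n" and i j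
  proof -
    have "(?A ** X) $ i $ j = (\<Sum>k\<in>UNIV. if k = ?t i then X $ k $ j else 0)"
      by (simp add: matrix_matrix_mult_def mat_def t[of i] mult_delta_left)
    then show ?thesis by simp
  qed
  have right: "(X ** transpose ?A) $ i $ j = X $ i $ ?t j" for X :: "real^'n^'n" and i j
  proof -
    have "(X ** transpose ?A) $ i $ j = (\<Sum>k\<in>UNIV. if k = ?t j then X $ i $ k else 0)"
      by (simp add: matrix_matrix_mult_def mat_def transpose_def t[of j] mult_delta_right)
    then show ?thesis by simp
  qed
  have "?A ** ?A = mat 1"
    by (simp add: vec_eq_iff left) (simp add: mat_def, metis transpose_involutory)
  then have "(det ?A)\<^sup>2 = 1" by (metis det_I det_mul power2_eq_square)
  then have det: "\<bar>det ?A\<bar> = 1" by (metis abs_1 power2_eq_1_iff abs_minus_cancel)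
  have eq: "sym_of_coords (\<lambda>e\<in>edges UNIV. x (?t ` e)) = ?A ** sym_of_coords x ** transpose ?A" for x
    by (simp add: vec_eq_iff left right)
  have f': "(\<lambda>x. f (sym_of_coords x)) \<in> borel_measurable ?P" by measurable
  have "(\<integral>\<^sup>+X. f X \<partial>sym_lebesgue) = (\<integral>\<^sup>+x. f (sym_of_coords x) \<partial>?P)"
    by (rule nn_integral_sym_lebesgue) simp
  also have "\<dots> = (\<integral>\<^sup>+x. f (sym_of_coords (\<lambda>e\<in>edges UNIV. x (?t ` e))) \<partial>?P)"
    by (rule nn_integral_PiM_lborel_involution[OF _ _ _ f', symmetric])
       (auto simp: edges_iff image_image)
  also have "\<dots> = (\<integral>\<^sup>+X. f (?A ** X ** transpose ?A) \<partial>sym_lebesgue)"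
    unfolding eq by (rule nn_integral_sym_lebesgue[symmetric]) simp
  finally show "(\<integral>\<^sup>+X. f X \<partial>sym_lebesgue) = ennreal (\<bar>det ?A\<bar> ^ (CARD('n) + 1)) *
      (\<integral>\<^sup>+X. f (?A ** X ** transpose ?A) \<partial>sym_lebesgue)"
    unfolding det by simp
qed

text \<open>
  Adding row n to row m, and column n to column m, is a composition of two shears: one changes
  the diagonal coordinate {m}, the other the coordinates {m, k} with k different from m.
\<close>

lemma scales_sym_lebesgue_transvection:
  fixes m n :: "'n::finite"
  assumes mn: "m \<noteq> n"
  shows "scales_sym_lebesgue (\<chi> i j. of_bool (i = m \<and> j = n \<or> i = j))" (is "scales_sym_lebesgue ?A")
proof -
  define A where "A = ?A"
  have "scales_sym_lebesgue A"
    unfolding scales_sym_lebesgue_def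
  proof
    fix f :: "real^'n^'n \<Rightarrow> ennreal" assume f[measurable]: "f \<in> borel_measurable borel"
    let ?E = "edges (UNIV::'n set)"
    let ?P = "\<Pi>\<^sub>M e\<in>?E. (lborel :: real measure)"
    have left: "(A ** X) $ i $ j = X $ i $ j + of_bool (i = m) * X $ n $ j" for X :: "real^'n^'n" and i j
    proof -
      have "(A ** X) $ i $ j = (\<Sum>k\<in>UNIV. (if k = i then X $ k $ j else 0) +
          (if k = n then of_bool (i = m) * X $ k $ j else 0))"
        unfolding matrix_matrix_mult_def A_def vec_lambda_beta using mn by (intro sum.cong) auto
      then show ?thesis by (simp add: sum.distrib)
    qed
    have right: "(X ** transpose A) $ i $ j = X $ i $ j + of_bool (j = m) * X $ i $ n" for X :: "real^'n^'n" and i j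
    proof -
      have "(X ** transpose A) $ i $ j = (\<Sum>k\<in>UNIV. (if k = j then X $ i $ k else 0) +
          (if k = n then of_bool (j = m) * X $ i $ k else 0))"
        unfolding matrix_matrix_mult_def A_def transpose_def vec_lambda_beta using mn by (intro sum.cong) auto
      then show ?thesis by (simp add: sum.distrib)
    qed
    have "A = (\<chi> k. if k = m then row m (mat 1) + 1 *s row n (mat 1) else row k (mat 1))"
      using mn by (auto simp: A_def vec_eq_iff row_def mat_def)
    then have det: "det A = 1" using det_row_operation[OF mn, of "mat 1" "1::real"] by simp
    \<comment> \<open>The new diagonal entry at {m} uses the old entry at {m, n}, so s1 acts before s2 changes the latter.\<close>
    define g1 where "g1 x e = 2 * x {m, n} + x {n}" for x :: "'n set \<Rightarrow> real" and e :: "'n set"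
    define g2 where "g2 x e = x (insert n (e - {m}))" for x :: "'n set \<Rightarrow> real" and e :: "'n set"
    define J2 where "J2 = {e \<in> ?E. m \<in> e \<and> e \<noteq> {m}}"
    define s1 where "s1 x = (\<lambda>e\<in>?E. if e \<in> {{m}} then x e + g1 x e else x e)" for x
    define s2 where "s2 x = (\<lambda>e\<in>?E. if e \<in> J2 then x e + g2 x e else x e)" for x
    have coord: "(\<lambda>x. x e) \<in> borel_measurable ?P" if "e \<in> ?E" for e
      using measurable_component_singleton[OF that, of "\<lambda>_. lborel :: real measure"] by simp
    have J2E: "insert n (e - {m}) \<in> ?E - J2" if "e \<in> J2" for e
      using that mn by (auto simp: J2_def edges_iff insert_Diff_if)
    have h: "(\<lambda>x. f (sym_of_coords x)) \<in> borel_measurable ?P" by measurable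
    have s2: "s2 \<in> ?P \<rightarrow>\<^sub>M ?P"
      unfolding s2_def
    proof (rule measurable_restrict)
      fix e assume e: "e \<in> ?E"
      show "(\<lambda>x. if e \<in> J2 then x e + g2 x e else x e) \<in> ?P \<rightarrow>\<^sub>M lborel"
        using coord[OF e] coord[of "insert n (e - {m})"] J2E[of e]
        by (cases "e \<in> J2") (simp_all add: g2_def)
    qed
    have eq: "sym_of_coords (s2 (s1 x)) = A ** sym_of_coords x ** transpose A" for x
    proof -
      have mm: "s2 (s1 x) {m} = x {m} + 2 * x {m, n} + x {n}"
        by (simp add: s2_def s1_def J2_def g1_def)
      have mk: "s2 (s1 x) {m, k} = x {m, k} + x {n, k}" if "k \<noteq> m" for k
      proof -
        have "insert n ({m, k} - {m}) = {n, k}" using that by auto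
        moreover have "{m, k} \<in> J2" using that by (auto simp: J2_def)
        ultimately show ?thesis using that mn by (auto simp: s2_def s1_def g2_def doubleton_eq_iff)
      qed
      have kl: "s2 (s1 x) {k, l} = x {k, l}" if "k \<noteq> m" "l \<noteq> m" for k l
        using that by (auto simp: s2_def s1_def J2_def)
      have "s2 (s1 x) {i, j} = (A ** sym_of_coords x ** transpose A) $ i $ j" for i j
        using mm mk[of j] mk[of i] kl[of i j]
        by (cases "i = m"; cases "j = m") (simp_all add: left right insert_commute)
      then show ?thesis by (simp add: vec_eq_iff)
    qed
    have "(\<integral>\<^sup>+X. f X \<partial>sym_lebesgue) = (\<integral>\<^sup>+x. f (sym_of_coords x) \<partial>?P)"
      by (rule nn_integral_sym_lebesgue) simp
    also have "\<dots> = (\<integral>\<^sup>+x. f (sym_of_coords (s2 x)) \<partial>?P)"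
      unfolding s2_def
    proof (rule nn_integral_PiM_lborel_shear[OF _ _ _ _ h])
      show "g2 x e = g2 y e" if "e \<in> J2" "\<And>i. i \<in> ?E - J2 \<Longrightarrow> x i = y i" for x y e
        unfolding g2_def using that(2)[OF J2E[OF that(1)]] .
      show "(\<lambda>x. g2 x e) \<in> borel_measurable ?P" if "e \<in> J2" for e
        unfolding g2_def using J2E[OF that] by (intro coord) auto
    qed (auto simp: J2_def)
    also have "\<dots> = (\<integral>\<^sup>+x. f (sym_of_coords (s2 (s1 x))) \<partial>?P)"
      unfolding s1_def
    proof (rule nn_integral_PiM_lborel_shear)
      show "g1 x e = g1 y e" if "\<And>i. i \<in> ?E - {{m}} \<Longrightarrow> x i = y i" for x y e
        unfolding g1_def using that[of "{m, n}"] that[of "{n}"] mn by (auto simp: doubleton_eq_iff)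
      show "(\<lambda>x. g1 x e) \<in> borel_measurable ?P" for e
        unfolding g1_def by (intro borel_measurable_add borel_measurable_times coord) auto
      show "(\<lambda>x. f (sym_of_coords (s2 x))) \<in> borel_measurable ?P"
        by (rule measurable_compose[OF s2 h])
    qed auto
    also have "\<dots> = (\<integral>\<^sup>+X. f (A ** X ** transpose A) \<partial>sym_lebesgue)"
      unfolding eq by (rule nn_integral_sym_lebesgue[symmetric]) simp
    finally show "(\<integral>\<^sup>+X. f X \<partial>sym_lebesgue) = ennreal (\<bar>det A\<bar> ^ (CARD('n) + 1)) *
        (\<integral>\<^sup>+X. f (A ** X ** transpose A) \<partial>sym_lebesgue)"
      unfolding det by simp
  qed
  then show ?thesis by (simp only: A_def)
qed

theorem nn_integral_sym_lebesgue_congruence: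
  fixes A :: "real^'n^'n"
  assumes A: "invertible A" and f: "f \<in> borel_measurable borel"
  shows "(\<integral>\<^sup>+X. f X \<partial>sym_lebesgue) =
     ennreal (\<bar>det A\<bar> ^ (CARD('n) + 1)) * (\<integral>\<^sup>+X. f (A ** X ** transpose A) \<partial>sym_lebesgue)"
proof -
  have "invertible A \<longrightarrow> scales_sym_lebesgue A"
  proof (induction A rule: induct_matrix_elementary_alt)
    fix A B :: "real^'n^'n"
    assume "invertible A \<longrightarrow> scales_sym_lebesgue A" "invertible B \<longrightarrow> scales_sym_lebesgue B"
    then show "invertible (A ** B) \<longrightarrow> scales_sym_lebesgue (A ** B)"
      by (auto simp: invertible_det_nz det_mul intro!: scales_sym_lebesgue_mult)
  next
    fix A :: "real^'n^'n" and i assume "row i A = 0"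
    then have "det A = 0" by (rule det_zero_row)
    then show "invertible A \<longrightarrow> scales_sym_lebesgue A" by (simp add: invertible_det_nz)
  next
    fix A :: "real^'n^'n" assume A: "\<And>i j. i \<noteq> j \<Longrightarrow> A $ i $ j = 0"
    then have eq: "A = diag_matrix (\<lambda>i. A $ i $ i)" by (auto simp: diag_matrix_def vec_eq_iff)
    show "invertible A \<longrightarrow> scales_sym_lebesgue A"
    proof
      assume "invertible A"
      then have "(\<Prod>i\<in>UNIV. A $ i $ i) \<noteq> 0"
        unfolding invertible_det_nz by (subst (asm) eq) (simp add: det_diag_matrix)
      then show "scales_sym_lebesgue A" by (subst eq) (intro scales_sym_lebesgue_diag_matrix, auto)
    qed
  next
    fix m n :: 'n assume "m \<noteq> n"
    show "invertible (\<chi> i j. mat 1 $ i $ Transposition.transpose m n j :: real^'n^'n) \<longrightarrow>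
        scales_sym_lebesgue (\<chi> i j. mat 1 $ i $ Transposition.transpose m n j :: real^'n^'n)"
      by (rule impI, rule scales_sym_lebesgue_swap)
    show "invertible (\<chi> i j. of_bool (i = m \<and> j = n \<or> i = j) :: real^'n^'n) \<longrightarrow>
        scales_sym_lebesgue (\<chi> i j. of_bool (i = m \<and> j = n \<or> i = j) :: real^'n^'n)"
      by (rule impI, rule scales_sym_lebesgue_transvection[OF \<open>m \<noteq> n\<close>])
  qed
  with A have "scales_sym_lebesgue A" by blast
  from bspec[OF this[unfolded scales_sym_lebesgue_def] f] show ?thesis .
qed

section \<open>Schur complements and the Wishart integral\<close>

lemma closed_form_bounded_below: "closed {X :: real^'n^'n. \<forall>v. c * (v \<bullet> v) \<le> v \<bullet> (X *v v)}"
proof -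
  have "closed {X :: real^'n^'n. c * (v \<bullet> v) \<le> v \<bullet> (X *v v)}" for v
    unfolding inner_vec_def matrix_vector_mult_def vec_lambda_beta inner_real_def
    by (intro closed_Collect_le continuous_intros)
  then have "closed (\<Inter>v. {X :: real^'n^'n. c * (v \<bullet> v) \<le> v \<bullet> (X *v v)})" by (intro closed_INT) auto
  moreover have "(\<Inter>v. {X :: real^'n^'n. c * (v \<bullet> v) \<le> v \<bullet> (X *v v)}) =
      {X. \<forall>v. c * (v \<bullet> v) \<le> v \<bullet> (X *v v)}" by auto
  ultimately show ?thesis by simp
qed

text \<open>
  Compactness of the unit sphere bounds the quadratic form away from 0.
\<close>

lemma spd_coercive:
  fixes X :: "real^'n^'n"
  assumes X: "X \<in> spd"
  obtains N :: nat where "\<And>v. (1 / real (Suc N)) * (v \<bullet> v) \<le> v \<bullet> (X *v v)"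
proof -
  have "axis (undefined :: 'n) 1 \<in> sphere (0 :: real^'n) 1" by simp
  then have "sphere (0 :: real^'n) 1 \<noteq> {}" by blast
  moreover have "continuous_on (sphere (0::real^'n) 1) (\<lambda>v. v \<bullet> (X *v v))"
    by (intro continuous_intros)
  ultimately obtain u where u: "u \<in> sphere 0 1"
    and min: "\<And>v. v \<in> sphere 0 1 \<Longrightarrow> u \<bullet> (X *v u) \<le> v \<bullet> (X *v v)"
    using continuous_attains_inf[of "sphere (0::real^'n) 1" "\<lambda>v. v \<bullet> (X *v v)"] compact_sphere by blast
  define c where "c = u \<bullet> (X *v u)"
  have "u \<noteq> 0" using u by auto
  then have "0 < c" unfolding c_def by (rule spd_pos[OF X])
  then obtain N where N: "1 / real (Suc N) < c" using nat_approx_posE by blast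
  have "(1 / real (Suc N)) * (v \<bullet> v) \<le> v \<bullet> (X *v v)" for v
  proof (cases "v = 0")
    case False
    have "c \<le> (v \<bullet> (X *v v)) / (norm v * norm v)"
      using min[of "(1 / norm v) *\<^sub>R v"] False by (simp add: c_def matrix_vector_mult_scaleR)
    then have "c * (v \<bullet> v) \<le> v \<bullet> (X *v v)"
      using False by (simp add: field_simps power2_norm_eq_inner[symmetric] power2_eq_square)
    moreover have "(1 / real (Suc N)) * (v \<bullet> v) \<le> c * (v \<bullet> v)"
      using N by (intro mult_right_mono) auto
    ultimately show ?thesis by linarith
  qed simp
  then show ?thesis by (rule that)
qed

text \<open>
  The strict inequalities range over uncountably many vectors; coercivity replaces them by a
  countable union of closed conditions.
\<close>

lemma spd_in_borel [measurable]: "(spd :: (real^'n^'n) set) \<in> sets borel"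
proof -
  have eq: "(spd :: (real^'n^'n) set) = {X. \<forall>i j. X $ i $ j = X $ j $ i} \<inter>
      (\<Union>N. {X. \<forall>v. (1 / real (Suc N)) * (v \<bullet> v) \<le> v \<bullet> (X *v v)})"
  proof (intro equalityI subsetI)
    fix X :: "real^'n^'n" assume X: "X \<in> spd"
    obtain N where "\<And>v. (1 / real (Suc N)) * (v \<bullet> v) \<le> v \<bullet> (X *v v)"
      using spd_coercive[OF X] by blast
    moreover have "X $ i $ j = X $ j $ i" for i j
      using arg_cong[OF spd_symmetric[OF X], of "\<lambda>M. M $ j $ i"] by (simp add: transpose_def)
    ultimately show "X \<in> {X. \<forall>i j. X $ i $ j = X $ j $ i} \<inter>
      (\<Union>N. {X. \<forall>v. (1 / real (Suc N)) * (v \<bullet> v) \<le> v \<bullet> (X *v v)})" by blast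
  next
    fix X :: "real^'n^'n"
    assume "X \<in> {X. \<forall>i j. X $ i $ j = X $ j $ i} \<inter>
      (\<Union>N. {X. \<forall>v. (1 / real (Suc N)) * (v \<bullet> v) \<le> v \<bullet> (X *v v)})"
    then obtain N where sym: "\<And>i j. X $ i $ j = X $ j $ i"
      and N: "\<And>v. (1 / real (Suc N)) * (v \<bullet> v) \<le> v \<bullet> (X *v v)" by auto
    have "transpose X = X" unfolding transpose_def vec_eq_iff vec_lambda_beta using sym by blast
    moreover have "0 < v \<bullet> (X *v v)" if "v \<noteq> 0" for v
    proof -
      have "0 < (1 / real (Suc N)) * (v \<bullet> v)" using that by simp
      with N[of v] show ?thesis by linarith
    qed
    ultimately show "X \<in> spd" by (simp add: spd_def)
  qed
  have "closed {X :: real^'n^'n. \<forall>v. (1 / real (Suc N)) * (v \<bullet> v) \<le> v \<bullet> (X *v v)}" for N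
    by (rule closed_form_bounded_below)
  then have B: "(\<Union>N. {X :: real^'n^'n. \<forall>v. (1 / real (Suc N)) * (v \<bullet> v) \<le> v \<bullet> (X *v v)}) \<in> sets borel"
    by (intro sets.countable_UN' borel_closed) auto
  have A: "{X :: real^'n^'n. \<forall>i j. X $ i $ j = X $ j $ i} \<in> sets borel"
  proof -
    have "closed {X :: real^'n^'n. \<forall>i j. X $ i $ j = X $ j $ i}"
      by (intro closed_Collect_all closed_Collect_eq continuous_intros)
    then show ?thesis by (rule borel_closed)
  qed
  show ?thesis unfolding eq by (rule sets.Int[OF A B])
qed

text \<open>
  The block of a symmetric matrix on the index set I, completed by the identity, which changes
  neither its determinant nor its definiteness. This permits induction on I while the
  matrix type stays the same.
\<close>

definition partial_sym :: "'n set \<Rightarrow> ('n set \<Rightarrow> real) \<Rightarrow> real^'n^'n" where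
  "partial_sym I x = (\<chi> i j. if i \<in> I \<and> j \<in> I then x {i, j} else of_bool (i = j))"

lemma partial_sym_nth: "partial_sym I x $ i $ j = (if i \<in> I \<and> j \<in> I then x {i, j} else of_bool (i = j))"
  by (simp add: partial_sym_def)

lemma partial_sym_UNIV: "partial_sym UNIV = sym_of_coords"
  by (simp add: partial_sym_def sym_of_coords_def fun_eq_iff)

lemma partial_sym_cong: "(\<And>e. e \<in> edges I \<Longrightarrow> x e = y e) \<Longrightarrow> partial_sym I x = partial_sym I y"
  by (simp add: partial_sym_def vec_eq_iff edges_iff) blast

definition pivot_matrix :: "'n \<Rightarrow> real^'n \<Rightarrow> real^'n^'n" where
  "pivot_matrix k w = (\<chi> i j. if j = k then w $ i else of_bool (i = j))"

lemma det_pivot_matrix: "det (pivot_matrix k w) = w $ k"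
proof -
  have "pivot_matrix k w = (\<chi> i j. if j = k then (mat 1 *v w) $ i else mat 1 $ i $ j)"
    by (simp add: pivot_matrix_def vec_eq_iff) (simp add: mat_def)
  then show ?thesis by (simp only: cramer_lemma det_I mult_1_right)
qed

text \<open>
  Splitting off the entry s = x {k} with the row v of x at k: the block of x on I is the Schur
  complement y plus v v^T / s. All of this is one congruence by the identity matrix whose column k is
  replaced by w, the row of x at k (including s) divided by the square root of s.
\<close>

lemma schur_pivot:
  fixes x y :: "'n::finite set \<Rightarrow> real"
  assumes k: "k \<notin> I" and s: "0 < x {k}"
    and x: "\<And>i j. i \<in> I \<Longrightarrow> j \<in> I \<Longrightarrow> x {i, j} = y {i, j} + x {k, i} * x {k, j} / x {k}"
  defines "w \<equiv> (\<chi> i. if i = k then sqrt (x {k}) else if i \<in> I then x {k, i} / sqrt (x {k}) else 0)"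
  shows "partial_sym (insert k I) x = pivot_matrix k w ** partial_sym I y ** transpose (pivot_matrix k w)"
proof -
  have left: "(pivot_matrix k w ** X) $ i $ j = (if i = k then 0 else X $ i $ j) + w $ i * X $ k $ j"
    for X :: "real^'n^'n" and i j
  proof -
    have "(pivot_matrix k w ** X) $ i $ j =
        (\<Sum>l\<in>UNIV. (if l = i then (if i = k then 0 else X $ l $ j) else 0) + (if l = k then w $ i * X $ l $ j else 0))"
      unfolding matrix_matrix_mult_def pivot_matrix_def vec_lambda_beta by (intro sum.cong) auto
    then show ?thesis by (simp add: sum.distrib)
  qed
  have right: "(X ** transpose (pivot_matrix k w)) $ i $ j = (if j = k then 0 else X $ i $ j) + w $ j * X $ i $ k"
    for X :: "real^'n^'n" and i j
  proof -
    have "(X ** transpose (pivot_matrix k w)) $ i $ j =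
        (\<Sum>l\<in>UNIV. (if l = j then (if j = k then 0 else X $ i $ l) else 0) + (if l = k then w $ j * X $ i $ l else 0))"
      unfolding matrix_matrix_mult_def pivot_matrix_def transpose_def vec_lambda_beta by (intro sum.cong) auto
    then show ?thesis by (simp add: sum.distrib)
  qed
  have ww: "sqrt (x {k}) * sqrt (x {k}) = x {k}" using s by simp
  have sq: "sqrt (x {k}) \<noteq> 0" using s by simp
  have "partial_sym (insert k I) x $ i $ j =
      (pivot_matrix k w ** partial_sym I y ** transpose (pivot_matrix k w)) $ i $ j" for i j
  proof -
    have "x {i, k} = x {k, i}" for i by (simp add: insert_commute)
    then show ?thesis
      unfolding right left partial_sym_nth using k x[of i j] ww sq
      by (cases "i = k"; cases "j = k"; cases "i \<in> I"; cases "j \<in> I") (auto simp: w_def)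
  qed
  then show ?thesis by (simp add: vec_eq_iff)
qed

text \<open>
  An unnormalized Wishart density with identity scale in dimension card I. The exponent a is not
  tied to the dimension, because one and the same a serves all I in the recursion; for I = UNIV it is
  (p - d - 1) / 2.
\<close>

definition partial_weight :: "'n::finite set \<Rightarrow> real \<Rightarrow> ('n set \<Rightarrow> real) \<Rightarrow> real" where
  "partial_weight I a x = (if partial_sym I x \<in> spd
     then det (partial_sym I x) powr a * exp (- (\<Sum>i\<in>I. x {i}) / 2) else 0)"

lemma partial_weight_nonneg [simp]: "0 \<le> partial_weight I a x"
  by (simp add: partial_weight_def)

lemma partial_weight_cong:
  "(\<And>e. e \<in> edges I \<Longrightarrow> x e = y e) \<Longrightarrow> partial_weight I a x = partial_weight I a y"
proof -
  assume e: "\<And>e. e \<in> edges I \<Longrightarrow> x e = y e"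
  have "x {i} = y {i}" if "i \<in> I" for i using e[of "{i}"] that by (auto simp: edges_iff)
  then show ?thesis using partial_sym_cong[of I x y] e by (simp add: partial_weight_def cong: sum.cong)
qed

lemma measurable_lborel_coord:
  "e \<in> E \<Longrightarrow> (\<lambda>x. x e) \<in> borel_measurable (\<Pi>\<^sub>M e\<in>E. (lborel :: real measure))"
  using measurable_component_singleton[of e E "\<lambda>_. lborel :: real measure"] by simp

lemma measurable_partial_weight:
  assumes "edges I \<subseteq> E"
  shows "partial_weight I a \<in> borel_measurable (\<Pi>\<^sub>M e\<in>E. (lborel :: real measure))"
proof -
  have p: "{i, j} \<in> E" if "i \<in> I" "j \<in> I" for i j
    using assms that by (meson edges_iff subsetD)
  have q: "{i} \<in> E" if "i \<in> I" for i using p[of i i] that by simp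
  have ps[measurable]: "partial_sym I \<in> borel_measurable (\<Pi>\<^sub>M e\<in>E. (lborel :: real measure))"
  proof (rule borel_measurable_matrix)
    fix i j
    show "(\<lambda>x. partial_sym I x $ i $ j) \<in> borel_measurable (\<Pi>\<^sub>M e\<in>E. (lborel :: real measure))"
      unfolding partial_sym_nth using p[of i j]
      by (cases "i \<in> I"; cases "j \<in> I") (simp_all add: measurable_lborel_coord)
  qed
  have [measurable]: "(\<lambda>x. \<Sum>i\<in>I. x {i}) \<in> borel_measurable (\<Pi>\<^sub>M e\<in>E. (lborel :: real measure))"
    by (intro borel_measurable_sum measurable_lborel_coord q)
  show ?thesis unfolding partial_weight_def by measurable
qed

text \<open>
  In the coordinates s, v and y of a pivot step the density factorizes: the determinant is s times
  that of y, and the trace is s + |v|^2 / s plus that of y.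
\<close>

lemma partial_weight_pivot:
  fixes x y :: "'n::finite set \<Rightarrow> real"
  assumes k: "k \<notin> I" and s: "0 < x {k}"
    and x: "\<And>i j. i \<in> I \<Longrightarrow> j \<in> I \<Longrightarrow> x {i, j} = y {i, j} + x {k, i} * x {k, j} / x {k}"
  shows "partial_weight (insert k I) a x =
    x {k} powr a * exp (- x {k} / 2) * (\<Prod>i\<in>I. exp (- (x {k, i})\<^sup>2 / (2 * x {k}))) * partial_weight I a y"
proof -
  define w where "w = (\<chi> i. if i = k then sqrt (x {k}) else if i \<in> I then x {k, i} / sqrt (x {k}) else 0)"
  define G where "G = pivot_matrix k w"
  have eq: "partial_sym (insert k I) x = G ** partial_sym I y ** transpose G"
    using schur_pivot[where x=x and y=y, OF k s x] by (simp add: G_def w_def)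
  have detG: "det G = sqrt (x {k})" by (simp add: G_def det_pivot_matrix w_def)
  have G: "invertible G" using s by (simp add: invertible_det_nz detG)
  have det: "det (partial_sym (insert k I) x) = x {k} * det (partial_sym I y)"
    using s by (simp add: eq det_mul detG mult_ac)
  have "(\<Sum>i\<in>insert k I. x {i}) = x {k} + (\<Sum>i\<in>I. y {i} + (x {k, i})\<^sup>2 / x {k})"
    using k x[of i i for i] by (simp add: power2_eq_square cong: sum.cong)
  moreover have "(\<Sum>i\<in>I. - (x {k, i})\<^sup>2 / (2 * x {k})) = - (\<Sum>i\<in>I. (x {k, i})\<^sup>2 / x {k}) / 2"
    by (simp add: sum_divide_distrib sum_negf mult.commute)
  ultimately have "exp (- (\<Sum>i\<in>insert k I. x {i}) / 2) = exp (- x {k} / 2) *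
      (exp (- (\<Sum>i\<in>I. y {i}) / 2) * exp (\<Sum>i\<in>I. - (x {k, i})\<^sup>2 / (2 * x {k})))"
    by (simp only: sum.distrib exp_add[symmetric]) (simp add: field_simps)
  then have ex: "exp (- (\<Sum>i\<in>insert k I. x {i}) / 2) = exp (- x {k} / 2) *
      (exp (- (\<Sum>i\<in>I. y {i}) / 2) * (\<Prod>i\<in>I. exp (- (x {k, i})\<^sup>2 / (2 * x {k}))))"
    by (simp add: exp_sum)
  show ?thesis
  proof (cases "partial_sym I y \<in> spd")
    case True
    then have "0 < det (partial_sym I y)" by (rule spd_det_pos)
    then have pw: "(x {k} * det (partial_sym I y)) powr a = x {k} powr a * det (partial_sym I y) powr a"
      using s by (simp add: powr_mult)
    then show ?thesis
      unfolding partial_weight_def eq spd_congruence_iff[OF G]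
      using True by (simp only: if_True det[unfolded eq] ex pw mult_ac)
  next
    case False
    then show ?thesis unfolding partial_weight_def eq spd_congruence_iff[OF G] by simp
  qed
qed

lemma partial_weight_nonpos_pivot:
  assumes "x {k} \<le> 0" shows "partial_weight (insert k I) a x = 0"
proof -
  have "axis k 1 \<bullet> (partial_sym (insert k I) x *v axis k 1) = x {k}"
    by (simp add: inner_axis' matrix_vector_mul_component inner_axis partial_sym_nth)
  moreover have "axis k 1 \<noteq> (0 :: real^'a)" by (simp add: axis_eq_0_iff)
  ultimately have "partial_sym (insert k I) x \<notin> spd"
    using spd_pos[of "partial_sym (insert k I) x" "axis k 1"] assms by fastforce
  then show ?thesis by (simp add: partial_weight_def)
qed

lemma nn_integral_gaussian:
  assumes s: "0 < s"
  shows "(\<integral>\<^sup>+t. ennreal (exp (- t\<^sup>2 / (2 * s))) \<partial>lborel) = ennreal (sqrt (2 * pi * s))"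
    and "(\<integral>\<^sup>+t. ennreal (t\<^sup>2) * ennreal (exp (- t\<^sup>2 / (2 * s))) \<partial>lborel) = ennreal (s * sqrt (2 * pi * s))"
proof -
  have nd: "exp (- t\<^sup>2 / (2 * s)) = sqrt (2 * pi * s) * normal_density 0 (sqrt s) t" for t
    using s by (simp add: normal_density_def)
  have one: "(\<integral>\<^sup>+t. ennreal (normal_density 0 (sqrt s) t) \<partial>lborel) = 1"
    using s by (subst nn_integral_eq_integral) simp_all
  have "has_bochner_integral lborel (\<lambda>t. normal_density 0 (sqrt s) t * (t - 0) ^ (2 * 1)) s"
    using normal_moment_even[of "sqrt s" 0 1] s by (simp add: fact_numeral field_simps)
  then have two: "(\<integral>\<^sup>+t. ennreal (normal_density 0 (sqrt s) t * t\<^sup>2) \<partial>lborel) = ennreal s"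
    by (subst nn_integral_eq_integral) (auto simp: has_bochner_integral_iff)
  show "(\<integral>\<^sup>+t. ennreal (exp (- t\<^sup>2 / (2 * s))) \<partial>lborel) = ennreal (sqrt (2 * pi * s))"
    unfolding nd using s by (simp add: ennreal_mult nn_integral_cmult one)
  have pt: "ennreal (t\<^sup>2) * ennreal (exp (- t\<^sup>2 / (2 * s))) =
      ennreal (sqrt (2 * pi * s)) * ennreal (normal_density 0 (sqrt s) t * t\<^sup>2)" for t
    unfolding nd using s by (simp add: mult_ac flip: ennreal_mult)
  show "(\<integral>\<^sup>+t. ennreal (t\<^sup>2) * ennreal (exp (- t\<^sup>2 / (2 * s))) \<partial>lborel) = ennreal (s * sqrt (2 * pi * s))"
    unfolding pt using s by (subst nn_integral_cmult) (simp_all add: two mult.commute flip: ennreal_mult)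
qed

text \<open>
  Euler's integral after the substitution t = s / 2.
\<close>

lemma nn_integral_gamma:
  assumes b: "-1 < b"
  shows "(\<integral>\<^sup>+s. ennreal (if 0 < s then s powr b * exp (- s / 2) else 0) \<partial>lborel) =
    ennreal (2 powr (b + 1) * Gamma (b + 1))"
proof -
  have eq: "indicator {0..} (0 + 1 / 2 * s) * (0 + 1 / 2 * s) powr b / exp (0 + 1 / 2 * s) =
      2 powr (- b) * (if 0 < s then s powr b * exp (- s / 2) else 0)" for s :: real
    by (cases s "0 :: real" rule: linorder_cases)
       (auto simp: indicator_def powr_divide powr_minus exp_minus field_simps)
  have "ennreal (Gamma (b + 1)) =
      (\<integral>\<^sup>+t. ennreal (indicator {0..} t * t powr b / exp t) \<partial>lborel)"
    using b by (subst Gamma_conv_nn_integral_real) simp_all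
  also have "\<dots> = ennreal \<bar>1 / 2\<bar> *
      (\<integral>\<^sup>+s. ennreal (indicator {0..} (0 + 1 / 2 * s) * (0 + 1 / 2 * s) powr b / exp (0 + 1 / 2 * s)) \<partial>lborel)"
    by (rule nn_integral_real_affine) simp_all
  also have "(\<integral>\<^sup>+s. ennreal (indicator {0..} (0 + 1 / 2 * s) * (0 + 1 / 2 * s) powr b / exp (0 + 1 / 2 * s)) \<partial>lborel) =
      ennreal (2 powr (- b)) * (\<integral>\<^sup>+s. ennreal (if 0 < s then s powr b * exp (- s / 2) else 0) \<partial>lborel)"
    unfolding eq by (subst nn_integral_cmult[symmetric]) (auto simp: ennreal_mult intro!: nn_integral_cong)
  finally have "ennreal (2 powr (b + 1)) * ennreal (Gamma (b + 1)) =
      ennreal (2 powr (b + 1)) * (ennreal \<bar>1 / 2\<bar> * (ennreal (2 powr (- b)) *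
        (\<integral>\<^sup>+s. ennreal (if 0 < s then s powr b * exp (- s / 2) else 0) \<partial>lborel)))" by simp
  also have "\<dots> = ennreal (2 powr (b + 1) * \<bar>1 / 2\<bar> * 2 powr (- b)) *
      (\<integral>\<^sup>+s. ennreal (if 0 < s then s powr b * exp (- s / 2) else 0) \<partial>lborel)"
    by (simp only: ennreal_mult'' mult.assoc[symmetric] abs_ge_zero powr_ge_zero)
  also have "2 powr (b + 1) * \<bar>1 / 2\<bar> * 2 powr (- b) = (1 :: real)"
    by (simp add: powr_add powr_minus)
  finally show ?thesis by (simp add: ennreal_mult')
qed

text \<open>
  One pivot step integrated out. Given s, the entries of the row at k are independent centred
  Gaussians of variance s and independent of the Schur complement. The test functions H and F
  make the total mass and the second moments of the row at k instances of one formula.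
\<close>

lemma nn_integral_partial_weight_pivot:
  fixes k :: "'n::finite" and H :: "real \<Rightarrow> ennreal" and F :: "'n \<Rightarrow> real \<Rightarrow> ennreal"
  assumes k: "k \<notin> I"
    and H [measurable]: "H \<in> borel_measurable borel" and F [measurable]: "\<And>i. F i \<in> borel_measurable borel"
  shows "(\<integral>\<^sup>+x. H (x {k}) * (\<Prod>i\<in>I. F i (x {k, i})) * ennreal (partial_weight (insert k I) a x)
      \<partial>(\<Pi>\<^sub>M e\<in>edges (insert k I). lborel)) =
    (\<integral>\<^sup>+x. ennreal (partial_weight I a x) \<partial>(\<Pi>\<^sub>M e\<in>edges I. lborel)) *
    (\<integral>\<^sup>+s. H s * ennreal (if 0 < s then s powr a * exp (- s / 2) else 0) *
       (\<Prod>i\<in>I. \<integral>\<^sup>+t. F i t * ennreal (exp (- t\<^sup>2 / (2 * s))) \<partial>lborel) \<partial>lborel)"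
proof -
  let ?P = "\<lambda>E. \<Pi>\<^sub>M e\<in>E. (lborel :: real measure)"
  define star where "star = (\<lambda>i. {k, i}) ` I"
  define K where "K = star \<union> edges I"
  have fin: "finite star" "finite (edges I)" "finite K" by (simp_all add: star_def K_def)
  have inj: "inj_on (\<lambda>i. {k, i}) I" using k by (auto simp: inj_on_def doubleton_eq_iff)
  have kstar: "k \<in> e" if "e \<in> star" for e using that by (auto simp: star_def)
  have kedges: "k \<notin> e" if "e \<in> edges I" for e using that k by (auto simp: edges_iff)
  have disj: "star \<inter> edges I = {}" using kstar kedges by blast
  have kK: "{k} \<notin> K" using k kedges by (auto simp: K_def star_def)
  have ins: "edges (insert k I) = insert {k} K"
    unfolding K_def star_def edges_def by (auto simp: image_iff)
  define \<Phi> where "\<Phi> x = H (x {k}) * (\<Prod>i\<in>I. F i (x {k, i})) * ennreal (partial_weight (insert k I) a x)" for x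
  have coordK: "(\<lambda>x. x {k, i}) \<in> borel_measurable (?P (insert {k} K))" if "i \<in> I" for i
    using that by (intro measurable_lborel_coord) (auto simp: K_def star_def)
  have coordk: "(\<lambda>x. x {k}) \<in> borel_measurable (?P (insert {k} K))"
    by (intro measurable_lborel_coord) auto
  have \<Phi>: "\<Phi> \<in> borel_measurable (?P (insert {k} K))"
    unfolding \<Phi>_def
    by (intro borel_measurable_times_ennreal borel_measurable_prod_ennreal measurable_compose[OF coordK F]
        measurable_compose[OF coordk H] measurable_compose[OF measurable_partial_weight measurable_ennreal])
       (auto simp: ins)
  define Z where "Z = (\<integral>\<^sup>+x. ennreal (partial_weight I a x) \<partial>?P (edges I))"
  define c where "c s = H s * ennreal (if 0 < s then s powr a * exp (- s / 2) else 0)" for s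
  define q where "q s i t = F i t * ennreal (exp (- t\<^sup>2 / (2 * s)))" for s t :: real and i
  have slice: "(\<integral>\<^sup>+x. \<Phi> (x({k} := s)) \<partial>?P K) = Z * (c s * (\<Prod>i\<in>I. \<integral>\<^sup>+t. q s i t \<partial>lborel))" for s
  proof (cases "0 < s")
    case False
    then show ?thesis by (simp add: \<Phi>_def c_def partial_weight_nonpos_pivot)
  next
    case s: True
    \<comment> \<open>Passing to the Schur complement of the entry s translates the block on I.\<close>
    define g where "g x e = edge_weight (\<lambda>i. x {k, i}) e / s" for x e
    define sh where "sh x = (\<lambda>e\<in>K. if e \<in> edges I then x e + g x e else x e)" for x
    have \<Phi>s: "(\<lambda>x. \<Phi> (x({k} := s))) \<in> borel_measurable (?P K)"
    proof (rule measurable_compose[OF _ \<Phi>])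
      show "(\<lambda>x. x({k} := s)) \<in> ?P K \<rightarrow>\<^sub>M ?P (insert {k} K)"
        by (rule measurable_fun_upd[where J=K]) auto
    qed
    have "(\<integral>\<^sup>+x. \<Phi> (x({k} := s)) \<partial>?P K) = (\<integral>\<^sup>+x. \<Phi> ((sh x)({k} := s)) \<partial>?P K)"
      unfolding sh_def
    proof (rule nn_integral_PiM_lborel_shear[OF fin(3) _ _ _ \<Phi>s])
      show "edges I \<subseteq> K" by (simp add: K_def)
      fix e assume e: "e \<in> edges I"
      then obtain i j where ij: "i \<in> I" "j \<in> I" "e = {i, j}" by (auto simp: edges_iff)
      have K: "{k, i} \<in> star" "{k, j} \<in> star" using ij by (auto simp: star_def)
      show "(\<lambda>x. g x e) \<in> borel_measurable (?P K)"
        unfolding g_def ij edge_weight_pair using K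
        by (intro borel_measurable_divide borel_measurable_times measurable_lborel_coord)
           (auto simp: K_def)
      fix x y :: "'n set \<Rightarrow> real" assume xy: "\<And>i. i \<in> K - edges I \<Longrightarrow> x i = y i"
      have "x {k, i} = y {k, i}" "x {k, j} = y {k, j}"
        using K disj by (auto intro!: xy simp: K_def)
      then show "g x e = g y e" unfolding g_def ij edge_weight_pair by simp
    qed
    \<comment> \<open>The row at k is indexed by the edges e = {k, i} from here on; i is recovered as the element
      of e - {k}.\<close>
    also have "\<dots> = (\<integral>\<^sup>+x. c s * ((\<Prod>e\<in>star. q s (the_elem (e - {k})) (x e)) * ennreal (partial_weight I a x)) \<partial>?P K)"
    proof (rule nn_integral_cong)
      fix x :: "'n set \<Rightarrow> real"
      define x' where "x' = (sh x)({k} := s)"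
      have xk: "x' {k} = s" by (simp add: x'_def)
      have star: "x' {k, i} = x {k, i}" if "i \<in> I" for i
      proof -
        have "{k, i} \<in> star" using that by (auto simp: star_def)
        moreover have "{k, i} \<noteq> {k}" using that k by auto
        ultimately show ?thesis using disj by (auto simp: x'_def sh_def K_def)
      qed
      have blk: "x' {i, j} = x {i, j} + x' {k, i} * x' {k, j} / x' {k}" if "i \<in> I" "j \<in> I" for i j
      proof -
        have "{i, j} \<in> edges I" using that by (auto simp: edges_iff)
        moreover have "i \<noteq> k" using that k by auto
        ultimately show ?thesis unfolding xk star[OF that(1)] star[OF that(2)]
          by (simp add: x'_def sh_def K_def g_def)
      qed
      have "partial_weight (insert k I) a x' = s powr a * exp (- s / 2) *
          (\<Prod>i\<in>I. exp (- (x {k, i})\<^sup>2 / (2 * s))) * partial_weight I a x"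
        using partial_weight_pivot[where x=x' and y=x and a=a, OF k _ blk] s
        by (simp add: xk star cong: prod.cong)
      then have pw: "ennreal (partial_weight (insert k I) a x') = ennreal (s powr a * exp (- s / 2)) *
          (\<Prod>i\<in>I. ennreal (exp (- (x {k, i})\<^sup>2 / (2 * s)))) * ennreal (partial_weight I a x)"
        by (simp add: ennreal_mult prod_nonneg prod_ennreal)
      have te: "the_elem ({i} - {k}) = i" if "i \<in> I" for i
      proof -
        have "{i} - {k} = {i}" using that k by auto
        then show ?thesis by simp
      qed
      have "(\<Prod>e\<in>star. q s (the_elem (e - {k})) (x e)) = (\<Prod>i\<in>I. q s i (x {k, i}))"
        unfolding star_def by (subst prod.reindex[OF inj]) (auto simp: te intro!: prod.cong)
      also have "\<dots> = (\<Prod>i\<in>I. F i (x {k, i})) * (\<Prod>i\<in>I. ennreal (exp (- (x {k, i})\<^sup>2 / (2 * s))))"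
        by (simp add: q_def prod.distrib)
      finally have qs: "(\<Prod>e\<in>star. q s (the_elem (e - {k})) (x e)) = \<dots>" .
      have "\<Phi> x' = H s * (\<Prod>i\<in>I. F i (x {k, i})) * ennreal (partial_weight (insert k I) a x')"
        by (simp add: \<Phi>_def xk star cong: prod.cong)
      also have "\<dots> = c s * ((\<Prod>e\<in>star. q s (the_elem (e - {k})) (x e)) * ennreal (partial_weight I a x))"
        unfolding pw qs c_def using s by (simp add: mult_ac)
      finally show "\<Phi> ((sh x)({k} := s)) =
          c s * ((\<Prod>e\<in>star. q s (the_elem (e - {k})) (x e)) * ennreal (partial_weight I a x))"
        by (simp add: x'_def)
    qed
    also have "\<dots> = c s * (\<integral>\<^sup>+x. (\<Prod>e\<in>star. q s (the_elem (e - {k})) (x e)) * ennreal (partial_weight I a x) \<partial>?P K)"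
    proof (rule nn_integral_cmult)
      have qm: "q s i \<in> borel_measurable borel" for i unfolding q_def by measurable
      show "(\<lambda>x. (\<Prod>e\<in>star. q s (the_elem (e - {k})) (x e)) * ennreal (partial_weight I a x)) \<in> borel_measurable (?P K)"
        by (intro borel_measurable_times_ennreal borel_measurable_prod_ennreal measurable_compose[OF measurable_lborel_coord qm]
            measurable_compose[OF measurable_partial_weight measurable_ennreal]) (auto simp: K_def)
    qed
    also have "(\<integral>\<^sup>+x. (\<Prod>e\<in>star. q s (the_elem (e - {k})) (x e)) * ennreal (partial_weight I a x) \<partial>?P K) =
        (\<integral>\<^sup>+v. (\<integral>\<^sup>+y. (\<Prod>e\<in>star. q s (the_elem (e - {k})) (merge star (edges I) (v, y) e)) *
          ennreal (partial_weight I a (merge star (edges I) (v, y))) \<partial>?P (edges I)) \<partial>?P star)"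
      unfolding K_def
    proof (rule lborel_product.product_nn_integral_fold[OF disj fin(1,2)])
      have qm: "q s i \<in> borel_measurable borel" for i unfolding q_def by measurable
      show "(\<lambda>x. (\<Prod>e\<in>star. q s (the_elem (e - {k})) (x e)) * ennreal (partial_weight I a x)) \<in> borel_measurable (?P (star \<union> edges I))"
        by (intro borel_measurable_times_ennreal borel_measurable_prod_ennreal measurable_compose[OF measurable_lborel_coord qm]
            measurable_compose[OF measurable_partial_weight measurable_ennreal]) auto
    qed
    also have "\<dots> = (\<integral>\<^sup>+v. (\<integral>\<^sup>+y. (\<Prod>e\<in>star. q s (the_elem (e - {k})) (v e)) * ennreal (partial_weight I a y) \<partial>?P (edges I)) \<partial>?P star)"
    proof (intro nn_integral_cong)
      fix v y :: "'n set \<Rightarrow> real"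
      have "partial_weight I a (merge star (edges I) (v, y)) = partial_weight I a y"
        using disj by (intro partial_weight_cong) (auto simp: merge_def)
      then show "(\<Prod>e\<in>star. q s (the_elem (e - {k})) (merge star (edges I) (v, y) e)) *
          ennreal (partial_weight I a (merge star (edges I) (v, y))) =
          (\<Prod>e\<in>star. q s (the_elem (e - {k})) (v e)) * ennreal (partial_weight I a y)"
        by (simp add: merge_def cong: prod.cong)
    qed
    also have "\<dots> = (\<integral>\<^sup>+v. (\<Prod>e\<in>star. q s (the_elem (e - {k})) (v e)) * Z \<partial>?P star)"
      unfolding Z_def
      by (intro nn_integral_cong nn_integral_cmult measurable_compose[OF measurable_partial_weight measurable_ennreal]) auto
    also have "\<dots> = (\<integral>\<^sup>+v. (\<Prod>e\<in>star. q s (the_elem (e - {k})) (v e)) \<partial>?P star) * Z"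
    proof (rule nn_integral_multc)
      have qm: "q s i \<in> borel_measurable borel" for i unfolding q_def by measurable
      show "(\<lambda>v. \<Prod>e\<in>star. q s (the_elem (e - {k})) (v e)) \<in> borel_measurable (?P star)"
        by (intro borel_measurable_prod_ennreal measurable_compose[OF measurable_lborel_coord qm]) auto
    qed
    also have "(\<integral>\<^sup>+v. (\<Prod>e\<in>star. q s (the_elem (e - {k})) (v e)) \<partial>?P star) =
        (\<Prod>e\<in>star. \<integral>\<^sup>+t. q s (the_elem (e - {k})) t \<partial>lborel)"
      by (rule lborel_product.product_nn_integral_prod[OF fin(1)]) (simp add: q_def)
    also have "\<dots> = (\<Prod>i\<in>I. \<integral>\<^sup>+t. q s i t \<partial>lborel)"
    proof -
      have "the_elem ({i} - {k}) = i" if "i \<in> I" for i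
      proof -
        have "{i} - {k} = {i}" using that k by auto
        then show ?thesis by simp
      qed
      then show ?thesis
        unfolding star_def by (subst prod.reindex[OF inj]) (auto intro!: prod.cong)
    qed
    finally show ?thesis by (simp only: mult_ac)
  qed
  have "(\<integral>\<^sup>+x. \<Phi> x \<partial>?P (edges (insert k I))) = (\<integral>\<^sup>+s. (\<integral>\<^sup>+x. \<Phi> (x({k} := s)) \<partial>?P K) \<partial>lborel)"
    unfolding ins by (rule lborel_product.product_nn_integral_insert_rev[OF fin(3) kK \<Phi>])
  also have "\<dots> = (\<integral>\<^sup>+s. Z * (c s * (\<Prod>i\<in>I. \<integral>\<^sup>+t. q s i t \<partial>lborel)) \<partial>lborel)"
    by (simp only: slice)
  also have "\<dots> = Z * (\<integral>\<^sup>+s. c s * (\<Prod>i\<in>I. \<integral>\<^sup>+t. q s i t \<partial>lborel) \<partial>lborel)"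
    by (rule nn_integral_cmult) (simp add: c_def q_def)
  finally show ?thesis by (simp add: \<Phi>_def Z_def c_def q_def)
qed

lemmas nn_integral_gaussian_normalized = nn_integral_gaussian[unfolded minus_divide_left[symmetric]]

text \<open>
  The mass contributed by a pivot next to a block of size m: m Gaussian integrals of variance s,
  integrated against s powr a * exp (- s / 2).
\<close>

definition wishart_factor :: "real \<Rightarrow> nat \<Rightarrow> real" where
  "wishart_factor a m = (2 * pi) powr (real m / 2) * (2 powr (a + real m / 2 + 1) * Gamma (a + real m / 2 + 1))"

lemma wishart_factor_pos:
  assumes "-1 < a" shows "0 < wishart_factor a m"
proof -
  have "0 < a + real m / 2 + 1" using assms by simp
  then show ?thesis unfolding wishart_factor_def by (intro mult_pos_pos Gamma_real_pos) simp_all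
qed

lemma pivot_integral:
  assumes a: "-1 < a + c"
  shows "(\<integral>\<^sup>+s. ennreal (s powr c) * ennreal (if 0 < s then s powr a * exp (- s / 2) else 0) *
      ennreal (sqrt (2 * pi * s)) ^ m \<partial>lborel) =
    ennreal ((2 * pi) powr (real m / 2) * (2 powr (a + c + real m / 2 + 1) * Gamma (a + c + real m / 2 + 1)))"
proof -
  have "ennreal (s powr c) * ennreal (if 0 < s then s powr a * exp (- s / 2) else 0) *
      ennreal (sqrt (2 * pi * s)) ^ m =
      ennreal ((2 * pi) powr (real m / 2)) *
      ennreal (if 0 < s then s powr (a + c + real m / 2) * exp (- s / 2) else 0)" for s :: real
  proof (cases "0 < s")
    case True
    have "sqrt (2 * pi * s) ^ m = (2 * pi) powr (real m / 2) * s powr (real m / 2)"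
      using True by (simp add: powr_half_sqrt[symmetric] powr_powr powr_mult flip: powr_realpow)
    then show ?thesis
      using True by (simp add: ennreal_power powr_add mult_ac flip: ennreal_mult)
  qed simp
  then have "(\<integral>\<^sup>+s. ennreal (s powr c) * ennreal (if 0 < s then s powr a * exp (- s / 2) else 0) *
      ennreal (sqrt (2 * pi * s)) ^ m \<partial>lborel) = ennreal ((2 * pi) powr (real m / 2)) *
      (\<integral>\<^sup>+s. ennreal (if 0 < s then s powr (a + c + real m / 2) * exp (- s / 2) else 0) \<partial>lborel)"
    by (simp add: nn_integral_cmult)
  also have "\<dots> = ennreal ((2 * pi) powr (real m / 2)) *
      ennreal (2 powr (a + c + real m / 2 + 1) * Gamma (a + c + real m / 2 + 1))"
    using a by (subst nn_integral_gamma) simp_all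
  finally show ?thesis by (simp add: ennreal_mult')
qed

lemma nn_integral_partial_weight_insert:
  fixes k :: "'n::finite"
  assumes k: "k \<notin> I" and a: "-1 < a"
  shows "(\<integral>\<^sup>+x. ennreal (partial_weight (insert k I) a x) \<partial>(\<Pi>\<^sub>M e\<in>edges (insert k I). lborel)) =
    (\<integral>\<^sup>+x. ennreal (partial_weight I a x) \<partial>(\<Pi>\<^sub>M e\<in>edges I. lborel)) * ennreal (wishart_factor a (card I))"
proof -
  have "(\<integral>\<^sup>+s. 1 * ennreal (if 0 < s then s powr a * exp (- s / 2) else 0) *
      (\<Prod>i\<in>I. \<integral>\<^sup>+t. 1 * ennreal (exp (- t\<^sup>2 / (2 * s))) \<partial>lborel) \<partial>lborel) =
      (\<integral>\<^sup>+s. ennreal (s powr 0) * ennreal (if 0 < s then s powr a * exp (- s / 2) else 0) *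
      ennreal (sqrt (2 * pi * s)) ^ card I \<partial>lborel)"
    by (intro nn_integral_cong) (simp add: nn_integral_gaussian_normalized)
  also have "\<dots> = ennreal (wishart_factor a (card I))"
    using a by (subst pivot_integral) (simp_all add: wishart_factor_def)
  finally show ?thesis
    using nn_integral_partial_weight_pivot[OF k, of "\<lambda>_. 1" "\<lambda>_ _. 1" a] by simp
qed

lemma nn_integral_partial_weight:
  fixes I :: "'n::finite set"
  assumes a: "-1 < a"
  shows "(\<integral>\<^sup>+x. ennreal (partial_weight I a x) \<partial>(\<Pi>\<^sub>M e\<in>edges I. lborel)) =
    ennreal (\<Prod>m<card I. wishart_factor a m)"
  using finite[of I]
proof (induction I rule: finite_induct)
  case empty
  have "partial_sym {} x = (mat 1 :: real^'n^'n)" for x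
    by (simp add: partial_sym_def mat_def vec_eq_iff)
  moreover have "(mat 1 :: real^'n^'n) \<in> spd"
    by (simp add: spd_def)
  ultimately show ?case
    by (simp add: partial_weight_def edges_def PiM_empty nn_integral_count_space_finite)
next
  case (insert k I)
  then show ?case
    using a wishart_factor_pos[OF a]
    by (simp add: nn_integral_partial_weight_insert ennreal_mult'' prod_nonneg less_imp_le)
qed

text \<open>
  The factors of all pivots multiply to the Wishart normalization: the powers of 2 and of pi add
  up as arithmetic series, and the Gamma factors are those of \<open>multigamma\<close> in reverse order.
\<close>

lemma prod_wishart_factor:
  assumes "0 < d"
  shows "(\<Prod>m<d. wishart_factor ((p - real d - 1) / 2) m) = 2 powr (p * real d / 2) * multigamma d (p / 2)"
proof -
  define a where "a = (p - real d - 1) / 2"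
  have sumr: "(\<Sum>m<n. real m) = real n * (real n - 1) / 2" for n
    by (induction n) (auto simp: field_simps)
  have "wishart_factor a m = pi powr (real m / 2) * 2 powr (real m / 2 + (a + real m / 2 + 1)) *
      Gamma (a + real m / 2 + 1)" for m
    unfolding wishart_factor_def powr_add[of 2 "real m / 2" "a + real m / 2 + 1"]
    by (simp add: powr_mult)
  then have "(\<Prod>m<d. wishart_factor a m) =
      (\<Prod>m<d. pi powr (real m / 2)) * (\<Prod>m<d. 2 powr (real m / 2 + (a + real m / 2 + 1))) *
      (\<Prod>m<d. Gamma (a + real m / 2 + 1))"
    by (simp only: prod.distrib)
  also have "(\<Prod>m<d. pi powr (real m / 2)) = pi powr (real d * (real d - 1) / 4)"
  proof -
    have "(\<Prod>m<d. pi powr (real m / 2)) = pi powr (\<Sum>m<d. real m / 2)" by (simp add: powr_sum)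
    also have "(\<Sum>m<d. real m / 2) = real d * (real d - 1) / 4"
      by (simp add: sumr flip: sum_divide_distrib)
    finally show ?thesis .
  qed
  also have "(\<Prod>m<d. 2 powr (real m / 2 + (a + real m / 2 + 1))) = 2 powr (p * real d / 2)"
  proof -
    have "(\<Prod>m<d. 2 powr (real m / 2 + (a + real m / 2 + 1))) = 2 powr (\<Sum>m<d. real m / 2 + (a + real m / 2 + 1))"
      by (simp add: powr_sum)
    also have "(\<Sum>m<d. real m / 2 + (a + real m / 2 + 1)) = (\<Sum>m<d. real m + (a + 1))"
      by (intro sum.cong) auto
    also have "\<dots> = p * real d / 2"
      by (simp add: sum.distrib sumr a_def) (simp add: field_simps)
    finally show ?thesis .
  qed
  also have "(\<Prod>m<d. Gamma (a + real m / 2 + 1)) = (\<Prod>j=1..d. Gamma (p / 2 - (real j - 1) / 2))"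
    by (rule prod.reindex_bij_witness[of _ "\<lambda>j. d - j" "\<lambda>m. d - m"])
       (auto simp: a_def of_nat_diff field_simps intro!: arg_cong[where f=Gamma])
  finally show ?thesis by (simp add: multigamma_def a_def mult_ac)
qed

text \<open>
  The pivot step for the whole matrix, the Schur complement being integrated out.
\<close>

lemma nn_integral_sym_lebesgue_partial_weight:
  fixes k :: "'n::finite" and H :: "real \<Rightarrow> ennreal" and F :: "'n \<Rightarrow> real \<Rightarrow> ennreal"
  assumes H [measurable]: "H \<in> borel_measurable borel" and F [measurable]: "\<And>i. F i \<in> borel_measurable borel"
    and a: "-1 < a"
  shows "(\<integral>\<^sup>+X. H (X $ k $ k) * (\<Prod>i\<in>UNIV - {k}. F i (X $ k $ i)) *
      ennreal (if X \<in> spd then det X powr a * exp (- trace X / 2) else 0) \<partial>(sym_lebesgue :: (real^'n^'n) measure)) =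
    ennreal (\<Prod>m<CARD('n) - 1. wishart_factor a m) *
    (\<integral>\<^sup>+s. H s * ennreal (if 0 < s then s powr a * exp (- s / 2) else 0) *
       (\<Prod>i\<in>UNIV - {k}. \<integral>\<^sup>+t. F i t * ennreal (exp (- t\<^sup>2 / (2 * s))) \<partial>lborel) \<partial>lborel)"
proof -
  have ins: "insert k (UNIV - {k}) = UNIV" by auto
  have "(\<integral>\<^sup>+X. H (X $ k $ k) * (\<Prod>i\<in>UNIV - {k}. F i (X $ k $ i)) *
      ennreal (if X \<in> spd then det X powr a * exp (- trace X / 2) else 0) \<partial>(sym_lebesgue :: (real^'n^'n) measure)) =
    (\<integral>\<^sup>+x. H (x {k}) * (\<Prod>i\<in>UNIV - {k}. F i (x {k, i})) * ennreal (partial_weight UNIV a x)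
      \<partial>(\<Pi>\<^sub>M e\<in>edges UNIV. lborel))"
    by (subst nn_integral_sym_lebesgue)
       (auto simp: partial_weight_def partial_sym_UNIV trace_def cong: if_cong)
  also have "\<dots> = (\<integral>\<^sup>+x. ennreal (partial_weight (UNIV - {k}) a x) \<partial>(\<Pi>\<^sub>M e\<in>edges (UNIV - {k}). lborel)) *
    (\<integral>\<^sup>+s. H s * ennreal (if 0 < s then s powr a * exp (- s / 2) else 0) *
       (\<Prod>i\<in>UNIV - {k}. \<integral>\<^sup>+t. F i t * ennreal (exp (- t\<^sup>2 / (2 * s))) \<partial>lborel) \<partial>lborel)"
    using nn_integral_partial_weight_pivot[of k "UNIV - {k}" H F a, unfolded ins] by simp
  finally show ?thesis by (simp add: nn_integral_partial_weight[OF a] card_Diff_singleton)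
qed

definition std_wishart_weight :: "real \<Rightarrow> real^'n^'n \<Rightarrow> real" where
  "std_wishart_weight p X = (if X \<in> spd
     then det X powr ((p - real CARD('n) - 1) / 2) * exp (- trace X / 2) else 0)"

text \<open>
  All three integrals use the pivot k. After the Gaussian integration they are Gamma integrals in
  s with exponent p / 2 - 1 raised by 0 for the mass, by 2 for the square of the pivot itself, and by
  1 for the square of an entry of its row, whose variance is s.
\<close>

lemma std_wishart_total_and_moments:
  fixes k l :: "'n::finite"
  assumes p: "real CARD('n) - 1 < p"
  defines "c \<equiv> 2 powr (p * real CARD('n) / 2) * multigamma CARD('n) (p / 2)"
  shows "0 < c"
    and "(\<integral>\<^sup>+X. ennreal (std_wishart_weight p X) \<partial>(sym_lebesgue :: (real^'n^'n) measure)) = ennreal c"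
    and "(\<integral>\<^sup>+X. ennreal ((X $ k $ k)\<^sup>2) * ennreal (std_wishart_weight p X) \<partial>(sym_lebesgue :: (real^'n^'n) measure)) =
      ennreal (p * (p + 2) * c)"
    and "k \<noteq> l \<Longrightarrow> (\<integral>\<^sup>+X. ennreal ((X $ k $ l)\<^sup>2) * ennreal (std_wishart_weight p X) \<partial>(sym_lebesgue :: (real^'n^'n) measure)) =
      ennreal (p * c)"
proof -
  define a where "a = (p - real CARD('n) - 1) / 2"
  define m where "m = CARD('n) - 1"
  have d0: "0 < CARD('n)" by simp
  then have dm: "CARD('n) = Suc m" by (simp add: m_def)
  have a: "-1 < a" using p by (simp add: a_def)
  have p0: "0 < p" using p dm by simp
  \<comment> \<open>The dimension cancels: the pivot next to a block of size d - 1 has a Gamma(p / 2) law.\<close>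
  have am: "a + real m / 2 + 1 = p / 2" unfolding a_def dm by (simp add: field_simps)
  define c0 where "c0 = (\<Prod>j<m. wishart_factor a j)"
  have c0: "0 < c0" unfolding c0_def by (intro prod_pos wishart_factor_pos a)
  have c_eq: "c = c0 * wishart_factor a m"
    unfolding c_def using prod_wishart_factor[OF d0, of p] by (simp add: c0_def dm a_def)
  then show "0 < c" using c0 wishart_factor_pos[OF a] by simp
  define f where "f = (2 * pi) powr (real m / 2)"
  have wf: "wishart_factor a m = f * (2 powr (p / 2) * Gamma (p / 2))"
    unfolding wishart_factor_def am f_def ..
  have G: "Gamma (z + 1) = z * Gamma z" if "0 < z" for z :: real
    using that by (intro Gamma_plus1) (auto elim!: nonpos_Ints_cases)
  have G1: "Gamma (p / 2 + 1) = p / 2 * Gamma (p / 2)" using p0 by (intro G) simp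
  have G2: "Gamma (p / 2 + 2) = (p / 2 + 1) * (p / 2) * Gamma (p / 2)"
    using G[of "p / 2 + 1"] p0 by (simp add: add.assoc G1)
  have card: "card (UNIV - {k}) = m" by (simp add: m_def card_Diff_singleton)
  have key: "(\<integral>\<^sup>+X. H (X $ k $ k) * (\<Prod>i\<in>UNIV - {k}. F i (X $ k $ i)) *
        ennreal (std_wishart_weight p X) \<partial>(sym_lebesgue :: (real^'n^'n) measure)) =
      ennreal (c0 * (f * (2 powr (p / 2 + b) * Gamma (p / 2 + b))))"
    if [measurable]: "H \<in> borel_measurable borel" "\<And>i. F i \<in> borel_measurable borel" and b: "0 \<le> b"
      and HF: "\<And>s. 0 < s \<Longrightarrow> H s * (\<Prod>i\<in>UNIV - {k}. \<integral>\<^sup>+t. F i t * ennreal (exp (- t\<^sup>2 / (2 * s))) \<partial>lborel) =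
          ennreal (s powr b) * ennreal (sqrt (2 * pi * s)) ^ m"
    for H :: "real \<Rightarrow> ennreal" and F :: "'n \<Rightarrow> real \<Rightarrow> ennreal" and b
  proof -
    have "(\<integral>\<^sup>+X. H (X $ k $ k) * (\<Prod>i\<in>UNIV - {k}. F i (X $ k $ i)) *
        ennreal (std_wishart_weight p X) \<partial>(sym_lebesgue :: (real^'n^'n) measure)) = ennreal c0 *
      (\<integral>\<^sup>+s. H s * ennreal (if 0 < s then s powr a * exp (- s / 2) else 0) *
       (\<Prod>i\<in>UNIV - {k}. \<integral>\<^sup>+t. F i t * ennreal (exp (- t\<^sup>2 / (2 * s))) \<partial>lborel) \<partial>lborel)"
      unfolding std_wishart_weight_def a_def[symmetric] c0_def m_def
      by (rule nn_integral_sym_lebesgue_partial_weight) (simp_all add: a)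
    also have "(\<integral>\<^sup>+s. H s * ennreal (if 0 < s then s powr a * exp (- s / 2) else 0) *
       (\<Prod>i\<in>UNIV - {k}. \<integral>\<^sup>+t. F i t * ennreal (exp (- t\<^sup>2 / (2 * s))) \<partial>lborel) \<partial>lborel) =
       (\<integral>\<^sup>+s. ennreal (s powr b) * ennreal (if 0 < s then s powr a * exp (- s / 2) else 0) *
         ennreal (sqrt (2 * pi * s)) ^ m \<partial>lborel)"
    proof (rule nn_integral_cong)
      fix s :: real
      show "H s * ennreal (if 0 < s then s powr a * exp (- s / 2) else 0) *
       (\<Prod>i\<in>UNIV - {k}. \<integral>\<^sup>+t. F i t * ennreal (exp (- t\<^sup>2 / (2 * s))) \<partial>lborel) =
       ennreal (s powr b) * ennreal (if 0 < s then s powr a * exp (- s / 2) else 0) *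
         ennreal (sqrt (2 * pi * s)) ^ m"
      proof (cases "0 < s")
        case True
        show ?thesis
          using arg_cong[OF HF[OF True], of "\<lambda>x. ennreal (if 0 < s then s powr a * exp (- s / 2) else 0) * x"]
          by (simp only: mult_ac)
      qed simp
    qed
    also have "\<dots> = ennreal (f * (2 powr (p / 2 + b) * Gamma (p / 2 + b)))"
    proof -
      have e: "a + b + real m / 2 + 1 = p / 2 + b" using am by simp
      have "-1 < a + b" using a b by simp
      from pivot_integral[OF this, of m] show ?thesis by (simp only: e f_def)
    qed
    finally show ?thesis using c0 by (simp add: ennreal_mult' less_imp_le)
  qed
  show "(\<integral>\<^sup>+X. ennreal (std_wishart_weight p X) \<partial>(sym_lebesgue :: (real^'n^'n) measure)) = ennreal c"
    using key[of "\<lambda>_. 1" "\<lambda>_ _. 1" 0] by (simp add: nn_integral_gaussian_normalized card c_eq wf)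
  have two: "2 powr (p / 2 + 1) = 2 * 2 powr (p / 2)" "2 powr (p / 2 + 2) = 4 * 2 powr (p / 2)"
    by (simp_all add: powr_add)
  have "c0 * (f * (2 powr (p / 2 + 2) * Gamma (p / 2 + 2))) = p * (p + 2) * c"
    unfolding two G2 c_eq wf by (simp add: field_simps)
  then show "(\<integral>\<^sup>+X. ennreal ((X $ k $ k)\<^sup>2) * ennreal (std_wishart_weight p X) \<partial>(sym_lebesgue :: (real^'n^'n) measure)) =
      ennreal (p * (p + 2) * c)"
    using key[of "\<lambda>s. ennreal (s\<^sup>2)" "\<lambda>_ _. 1" 2] by (simp add: nn_integral_gaussian_normalized card powr_numeral)
  show "(\<integral>\<^sup>+X. ennreal ((X $ k $ l)\<^sup>2) * ennreal (std_wishart_weight p X) \<partial>(sym_lebesgue :: (real^'n^'n) measure)) =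
      ennreal (p * c)" if kl: "k \<noteq> l"
  proof -
    define F where "F i t = (if i = l then ennreal (t\<^sup>2) else 1)" for i :: 'n and t :: real
    have prodF: "(\<Prod>i\<in>UNIV - {k}. F i (X $ k $ i)) = ennreal ((X $ k $ l)\<^sup>2)" for X :: "real^'n^'n"
      unfolding F_def using kl by (subst prod.delta) auto
    have intF: "(\<Prod>i\<in>UNIV - {k}. \<integral>\<^sup>+t. F i t * ennreal (exp (- t\<^sup>2 / (2 * s))) \<partial>lborel) =
        ennreal (s powr 1) * ennreal (sqrt (2 * pi * s)) ^ m" if s: "0 < s" for s
    proof -
      have "(\<integral>\<^sup>+t. F i t * ennreal (exp (- t\<^sup>2 / (2 * s))) \<partial>lborel) =
          (if i = l then ennreal s else 1) * ennreal (sqrt (2 * pi * s))" for i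
        using s nn_integral_gaussian_normalized[OF s] by (simp add: F_def ennreal_mult')
      then have "(\<Prod>i\<in>UNIV - {k}. \<integral>\<^sup>+t. F i t * ennreal (exp (- t\<^sup>2 / (2 * s))) \<partial>lborel) =
          (\<Prod>i\<in>UNIV - {k}. if i = l then ennreal s else 1) * ennreal (sqrt (2 * pi * s)) ^ m"
        by (simp only: prod.distrib prod_constant card)
      also have "(\<Prod>i\<in>UNIV - {k}. if i = l then ennreal s else 1) = ennreal (s powr 1)"
        using kl s by (subst prod.delta) auto
      finally show ?thesis .
    qed
    have [measurable]: "F i \<in> borel_measurable borel" for i
      unfolding F_def by measurable
    have "c0 * (f * (2 powr (p / 2 + 1) * Gamma (p / 2 + 1))) = p * c"
      unfolding two G1 c_eq wf by (simp add: field_simps)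
    then show ?thesis
      using key[of "\<lambda>_. 1" F 1] intF by (simp add: prodF)
  qed
qed

section \<open>Wishart laws: congruences and second moments\<close>

lemma spd_lebesgue_eq: "spd_lebesgue = restrict_space sym_lebesgue spd"
  by (simp add: spd_lebesgue_def edges_def UNIV_Times_UNIV)

lemma borel_measurable_wishart_density [measurable]:
  "wishart_density S p \<in> borel_measurable borel"
  unfolding wishart_density_def by measurable

lemma borel_measurable_spd_lebesgue:
  "f \<in> borel_measurable borel \<Longrightarrow> f \<in> borel_measurable spd_lebesgue"
  unfolding spd_lebesgue_eq by (intro measurable_restrict_space1) simp

lemma borel_measurable_wishart:
  "f \<in> borel_measurable borel \<Longrightarrow> f \<in> borel_measurable (wishart S p)"
  unfolding wishart_def by (simp add: borel_measurable_spd_lebesgue)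

text \<open>
  Rewriting integrals over a Wishart law as integrals over all symmetric matrices makes the
  Jacobian formula applicable.
\<close>

lemma nn_integral_wishart:
  fixes S :: "real^'n^'n"
  assumes f [measurable]: "f \<in> borel_measurable borel"
  shows "(\<integral>\<^sup>+X. f X \<partial>wishart S p) =
    (\<integral>\<^sup>+X. f X * ennreal (if X \<in> spd then wishart_density S p X else 0) \<partial>sym_lebesgue)"
proof -
  have "(\<integral>\<^sup>+X. f X \<partial>wishart S p) = (\<integral>\<^sup>+X. ennreal (wishart_density S p X) * f X \<partial>spd_lebesgue)"
    unfolding wishart_def by (intro nn_integral_density borel_measurable_spd_lebesgue) measurable
  also have "\<dots> = (\<integral>\<^sup>+X. ennreal (wishart_density S p X) * f X * indicator spd X \<partial>sym_lebesgue)"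
    unfolding spd_lebesgue_eq by (intro nn_integral_restrict_space) simp
  also have "\<dots> = (\<integral>\<^sup>+X. f X * ennreal (if X \<in> spd then wishart_density S p X else 0) \<partial>sym_lebesgue)"
    by (intro nn_integral_cong) (simp add: indicator_def mult.commute)
  finally show ?thesis .
qed

lemma matrix_inv_congruence:
  fixes A S :: "real^'n^'n"
  assumes A: "invertible A" and S: "invertible S"
  shows "matrix_inv (A ** S ** transpose A) = transpose (matrix_inv A) ** matrix_inv S ** matrix_inv A"
proof (rule matrix_inv_eqI)
  have "transpose A ** transpose (matrix_inv A) = mat 1"
    by (simp add: A matrix_inv_inverse flip: matrix_transpose_mul)
  then have "A ** S ** (transpose A ** transpose (matrix_inv A)) ** matrix_inv S ** matrix_inv A = mat 1"
    by (simp add: A S matrix_inv_inverse matrix_mul_assoc[of A S, symmetric])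
  then show "A ** S ** transpose A ** (transpose (matrix_inv A) ** matrix_inv S ** matrix_inv A) = mat 1"
    by (simp add: matrix_mul_assoc)
qed

lemma wishart_density_congruence:
  fixes A S X :: "real^'n^'n"
  assumes A: "invertible A" and S: "S \<in> spd" and X: "X \<in> spd"
  shows "wishart_density S p X =
    \<bar>det A\<bar> ^ (CARD('n) + 1) * wishart_density (A ** S ** transpose A) p (A ** X ** transpose A)"
proof -
  define t where "t = \<bar>det A\<bar>"
  have t: "0 < t" using A by (simp add: t_def invertible_det_nz)
  have tp: "(t\<^sup>2 * y) powr e = t powr (2 * e) * y powr e" if "0 < y" for y e
    using that t by (simp add: powr_mult powr_powr flip: powr_numeral)
  have detX: "det (A ** X ** transpose A) = t\<^sup>2 * det X" for X :: "real^'n^'n"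
    by (simp add: det_mul det_transpose t_def power2_eq_square mult_ac)
  have tr: "trace (matrix_inv (A ** S ** transpose A) ** (A ** X ** transpose A)) = trace (matrix_inv S ** X)"
  proof -
    have inv: "transpose A ** transpose (matrix_inv A) = mat 1"
      by (simp add: A matrix_inv_inverse flip: matrix_transpose_mul)
    have "matrix_inv (A ** S ** transpose A) ** (A ** X ** transpose A) =
        transpose (matrix_inv A) ** (matrix_inv S ** (matrix_inv A ** A) ** X ** transpose A)"
      by (simp add: matrix_inv_congruence A spd_invertible[OF S] matrix_mul_assoc)
    then have "trace (matrix_inv (A ** S ** transpose A) ** (A ** X ** transpose A)) =
        trace (matrix_inv S ** (matrix_inv A ** A) ** X ** transpose A ** transpose (matrix_inv A))"
      by (simp only: trace_mul_sym[of "transpose (matrix_inv A)"])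
    also have "\<dots> = trace (matrix_inv S ** X ** (transpose A ** transpose (matrix_inv A)))"
      by (simp add: matrix_inv_inverse[OF A] matrix_mul_assoc)
    finally show ?thesis by (simp add: inv)
  qed
  have "t ^ (CARD('n) + 1) = t powr (real CARD('n) + 1)"
    using powr_realpow[OF t, of "CARD('n) + 1"] by (simp add: add.commute)
  then have tt: "t ^ (CARD('n) + 1) * t powr (p - real CARD('n) - 1) = t powr p"
    by (simp only: powr_add[symmetric]) simp
  have ee: "2 * ((p - real CARD('n) - 1) / 2) = p - real CARD('n) - 1" "2 * (p / 2) = p" by simp_all
  have "wishart_density (A ** S ** transpose A) p (A ** X ** transpose A) * t ^ (CARD('n) + 1) =
      t powr p * (det X powr ((p - real CARD('n) - 1) / 2) * exp (- (1/2) * trace (matrix_inv S ** X)))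
     / (t powr p * (2 powr (p * real CARD('n) / 2) * det S powr (p / 2) * multigamma CARD('n) (p / 2)))"
    unfolding wishart_density_def tr detX tp[OF spd_det_pos[OF X]] tp[OF spd_det_pos[OF S]] ee
    by (simp only: times_divide_eq_left times_divide_eq_right tt[symmetric] mult_ac)
  also have "\<dots> = wishart_density S p X"
    using t by (simp add: wishart_density_def)
  finally show ?thesis by (simp add: t_def mult.commute)
qed

lemma sets_wishart_iff: "B \<in> sets (wishart S p) \<longleftrightarrow> B \<in> sets borel \<and> B \<subseteq> spd"
  using spd_in_borel by (auto simp: sets_wishart sets_restrict_space_iff)

lemma measurable_wishart:
  assumes "F \<in> borel_measurable borel" "\<And>X. X \<in> spd \<Longrightarrow> F X \<in> spd"
  shows "F \<in> wishart S p \<rightarrow>\<^sub>M wishart S' p'"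
proof -
  have "F \<in> restrict_space borel spd \<rightarrow>\<^sub>M restrict_space borel spd"
    using assms by (intro measurable_restrict_space3) auto
  then show ?thesis by (simp cong: measurable_cong_sets add: sets_wishart)
qed

text \<open>
  The Jacobian |det A| ^ (d + 1) is exactly the ratio of the two densities: the normalizing
  powers of the determinants of the scales and the powers of det X supply |det A| powr p and
  |det A| powr (p - d - 1).
\<close>

theorem distr_wishart_congruence:
  fixes A S :: "real^'n^'n"
  assumes A: "invertible A" and S: "S \<in> spd"
  shows "distr (wishart S p) (wishart (A ** S ** transpose A) q) (\<lambda>X. A ** X ** transpose A) =
    wishart (A ** S ** transpose A) p"
proof (rule measure_eqI)
  let ?S = "A ** S ** transpose A" and ?F = "\<lambda>X. A ** X ** transpose A"
  show "sets (distr (wishart S p) (wishart ?S q) ?F) = sets (wishart ?S p)"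
    by (simp add: sets_wishart)
  have F: "?F \<in> wishart S p \<rightarrow>\<^sub>M wishart ?S q"
    by (rule measurable_wishart) (simp_all add: spd_congruence A)
  fix B assume "B \<in> sets (distr (wishart S p) (wishart ?S q) ?F)"
  then have B: "B \<in> sets (wishart ?S q)" and [measurable]: "B \<in> sets borel"
    by (simp_all add: sets_wishart_iff)
  then have B': "B \<in> sets (wishart ?S p)" by (simp add: sets_wishart_iff)
  define g where "g X = indicator B X * ennreal (if X \<in> spd then wishart_density ?S p X else 0)" for X
  have [measurable]: "g \<in> borel_measurable borel" unfolding g_def by measurable
  have g: "ennreal (\<bar>det A\<bar> ^ (CARD('n) + 1)) * g (?F X) =
      indicator B (?F X) * ennreal (if X \<in> spd then wishart_density S p X else 0)" for X
    using wishart_density_congruence[OF A S, of X p]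
    by (simp add: g_def spd_congruence_iff[OF A] ennreal_mult' mult_ac)
  have "emeasure (distr (wishart S p) (wishart ?S q) ?F) B =
      (\<integral>\<^sup>+X. indicator B X \<partial>distr (wishart S p) (wishart ?S q) ?F)"
    using B by simp
  also have "\<dots> = (\<integral>\<^sup>+X. indicator B (?F X) \<partial>wishart S p)"
    using B by (subst nn_integral_distr[OF F]) auto
  also have "\<dots> = (\<integral>\<^sup>+X. ennreal (\<bar>det A\<bar> ^ (CARD('n) + 1)) * g (?F X) \<partial>sym_lebesgue)"
    unfolding g by (rule nn_integral_wishart) measurable
  also have "\<dots> = ennreal (\<bar>det A\<bar> ^ (CARD('n) + 1)) * (\<integral>\<^sup>+X. g (?F X) \<partial>sym_lebesgue)"
    by (rule nn_integral_cmult) measurable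
  also have "\<dots> = (\<integral>\<^sup>+X. g X \<partial>sym_lebesgue)"
    by (rule nn_integral_sym_lebesgue_congruence[OF A, symmetric]) simp
  also have "\<dots> = (\<integral>\<^sup>+X. indicator B X \<partial>wishart ?S p)"
    unfolding g_def by (rule nn_integral_wishart[symmetric]) measurable
  also have "\<dots> = emeasure (wishart ?S p) B" using B' by simp
  finally show "emeasure (distr (wishart S p) (wishart ?S q) ?F) B = emeasure (wishart ?S p) B" .
qed

lemma nn_integral_wishart_congruence:
  fixes A S :: "real^'n^'n"
  assumes A: "invertible A" and S: "S \<in> spd" and f: "f \<in> borel_measurable borel"
  shows "(\<integral>\<^sup>+X. f X \<partial>wishart (A ** S ** transpose A) p) = (\<integral>\<^sup>+X. f (A ** X ** transpose A) \<partial>wishart S p)"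
proof -
  have F: "(\<lambda>X. A ** X ** transpose A) \<in> wishart S p \<rightarrow>\<^sub>M wishart (A ** S ** transpose A) p"
    by (rule measurable_wishart) (simp_all add: spd_congruence A)
  show ?thesis
    by (subst distr_wishart_congruence[OF A S, of p p, symmetric])
       (intro nn_integral_distr F, simp add: borel_measurable_wishart f)
qed

lemma mat_1_spd [simp]: "mat 1 \<in> spd"
  by (simp add: spd_def)

lemma nn_integral_std_wishart:
  fixes f :: "real^'n^'n \<Rightarrow> ennreal"
  assumes p: "real CARD('n) - 1 < p" and f [measurable]: "f \<in> borel_measurable borel"
  defines "c \<equiv> 2 powr (p * real CARD('n) / 2) * multigamma CARD('n) (p / 2)"
  shows "(\<integral>\<^sup>+X. f X \<partial>wishart (mat 1) p) =
    (\<integral>\<^sup>+X. f X * ennreal (std_wishart_weight p X) \<partial>sym_lebesgue) * ennreal (1 / c)"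
proof -
  have "0 < c" unfolding c_def by (rule std_wishart_total_and_moments(1)[OF p])
  have inv: "matrix_inv (mat 1 :: real^'n^'n) = mat 1" by (rule matrix_inv_eqI) simp
  have "f X * ennreal (if X \<in> spd then wishart_density (mat 1) p X else 0) =
      f X * ennreal (std_wishart_weight p X) * ennreal (1 / c)" for X :: "real^'n^'n"
    using \<open>0 < c\<close>
    by (simp add: std_wishart_weight_def wishart_density_def inv c_def mult.assoc flip: ennreal_mult')
  moreover have "std_wishart_weight p \<in> borel_measurable (borel :: (real^'n^'n) measure)"
    unfolding std_wishart_weight_def by measurable
  ultimately show ?thesis
    by (simp add: nn_integral_wishart nn_integral_multc)
qed

lemma std_wishart_moments:
  fixes k l :: "'n::finite"
  assumes p: "real CARD('n) - 1 < p"
  shows "(\<integral>\<^sup>+X. 1 \<partial>wishart (mat 1 :: real^'n^'n) p) = 1"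
    and "(\<integral>\<^sup>+X. ennreal ((X $ k $ l)\<^sup>2) \<partial>wishart (mat 1 :: real^'n^'n) p) =
      ennreal (if k = l then p * (p + 2) else p)"
proof -
  define c where "c = 2 powr (p * real CARD('n) / 2) * multigamma CARD('n) (p / 2)"
  note m = std_wishart_total_and_moments[OF p, folded c_def]
  have c: "0 < c" by (rule m(1))
  show "(\<integral>\<^sup>+X. 1 \<partial>wishart (mat 1 :: real^'n^'n) p) = 1"
    using c by (subst nn_integral_std_wishart[OF p]) (simp_all add: m(2) flip: c_def ennreal_mult')
  show "(\<integral>\<^sup>+X. ennreal ((X $ k $ l)\<^sup>2) \<partial>wishart (mat 1 :: real^'n^'n) p) =
      ennreal (if k = l then p * (p + 2) else p)"
    using c by (subst nn_integral_std_wishart[OF p])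
      (auto simp: m(3) m(4)[of k l] simp flip: c_def ennreal_mult'')
qed

lemma wishart_spd_sqrt:
  assumes S: "S \<in> spd"
  obtains A :: "real^'n^'n" where "invertible A" "A ** mat 1 ** transpose A = S"
  by (rule that[of "spd_sqrt S"]) (simp_all add: spd_sqrt[OF S] spd_invertible spd_symmetric)

lemma prob_space_wishart:
  fixes S :: "real^'n^'n"
  assumes p: "real CARD('n) - 1 < p" and S: "S \<in> spd"
  shows "prob_space (wishart S p)"
proof
  obtain A :: "real^'n^'n" where A: "invertible A" "A ** mat 1 ** transpose A = S" by (rule wishart_spd_sqrt[OF S])
  have "(\<integral>\<^sup>+X. 1 \<partial>wishart S p) = 1"
    using nn_integral_wishart_congruence[OF A(1) mat_1_spd, of "\<lambda>_. 1" p] std_wishart_moments(1)[OF p]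
    by (simp only: A(2)) simp
  then show "emeasure (wishart S p) (space (wishart S p)) = 1" by simp
qed

lemma norm_orthogonal_congruence:
  fixes Q Y :: "real^'n^'n"
  assumes Q: "orthogonal_matrix Q"
  shows "norm (Q ** Y ** transpose Q) = norm Y"
proof -
  have "transpose (Q ** Y ** transpose Q) ** (Q ** Y ** transpose Q) =
      Q ** (transpose Y ** (transpose Q ** Q) ** Y ** transpose Q)"
    by (simp add: transpose_congruence matrix_mul_assoc)
  also have "\<dots> = Q ** (transpose Y ** Y ** transpose Q)"
    using Q by (simp add: orthogonal_matrix)
  finally have "(norm (Q ** Y ** transpose Q))\<^sup>2 = trace (Q ** (transpose Y ** Y ** transpose Q))"
    by (simp only: norm_matrix_squared_trace)
  also have "\<dots> = trace (transpose Y ** Y ** transpose Q ** Q)" by (rule trace_mul_sym)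
  also have "\<dots> = trace (transpose Y ** Y ** (transpose Q ** Q))" by (simp only: matrix_mul_assoc)
  also have "\<dots> = (norm Y)\<^sup>2" using Q by (simp add: orthogonal_matrix norm_matrix_squared_trace)
  finally show ?thesis by simp
qed

lemma wishart_shape_pos:
  assumes "real CARD('n::finite) - 1 < p"
  shows "0 < p"
proof -
  have "1 \<le> CARD('n)" by (simp add: Suc_le_eq)
  then show ?thesis using assms by linarith
qed

text \<open>
  Diagonalizing the scale as Q diag(d) Q^T, a Wishart matrix is the congruence by Q diag(sqrt d)
  of a standard one, W. Orthogonal congruences preserve the Frobenius norm, so the squared norm is the
  sum of d i * d j * (W i j)^2 and only squares of single entries of W have to be averaged.
\<close>

theorem nn_integral_norm_squared_wishart:
  fixes S :: "real^'n^'n"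
  assumes p: "real CARD('n) - 1 < p" and S: "S \<in> spd"
  shows "(\<integral>\<^sup>+X. ennreal ((norm X)\<^sup>2) \<partial>wishart S p) =
    ennreal (p * (p + 1) * (norm S)\<^sup>2 + p * (trace S)\<^sup>2)"
proof -
  obtain Q d where Q: "orthogonal_matrix Q" and SQ: "S = Q ** diag_matrix d ** transpose Q"
    and d: "\<forall>i. 0 < d i" by (rule spd_diagonalization[OF S])
  define r where "r = diag_matrix (\<lambda>i. sqrt (d i))"
  define A where "A = Q ** r"
  have p0: "0 < p" by (rule wishart_shape_pos[OF p])
  have "det r = (\<Prod>i\<in>UNIV. sqrt (d i))" by (simp add: r_def det_diag_matrix)
  also have "\<dots> \<noteq> 0" using d by (simp add: less_imp_neq[symmetric])
  finally have A: "invertible A"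
    using orthogonal_matrix_invertible[OF Q] by (simp add: A_def invertible_det_nz det_mul)
  have At: "A ** X ** transpose A = Q ** (r ** X ** r) ** transpose Q" for X
    by (simp add: A_def matrix_transpose_mul matrix_mul_assoc r_def)
  have rr: "r ** r = diag_matrix d"
    using d by (simp add: r_def diag_matrix_mult less_imp_le)
  have AS: "A ** mat 1 ** transpose A = S" unfolding At using rr by (simp add: SQ)
  have n: "(norm (A ** X ** transpose A))\<^sup>2 = (\<Sum>i\<in>UNIV. \<Sum>j\<in>UNIV. d i * d j * (X $ i $ j)\<^sup>2)" for X
  proof -
    have "(norm (r ** X ** r))\<^sup>2 = (\<Sum>i\<in>UNIV. \<Sum>j\<in>UNIV. d i * d j * (X $ i $ j)\<^sup>2)"
      unfolding norm_matrix_squared r_def diag_matrix_congruence_nth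
      using d by (intro sum.cong refl) (simp add: power_mult_distrib less_imp_le mult_ac)
    then show ?thesis by (simp add: At norm_orthogonal_congruence[OF Q])
  qed
  have "(\<integral>\<^sup>+X. ennreal ((norm X)\<^sup>2) \<partial>wishart S p) =
      (\<integral>\<^sup>+X. ennreal ((norm (A ** X ** transpose A))\<^sup>2) \<partial>wishart (mat 1) p)"
    by (subst AS[symmetric], rule nn_integral_wishart_congruence[OF A mat_1_spd]) simp
  also have "\<dots> = (\<integral>\<^sup>+X. (\<Sum>i\<in>UNIV. \<Sum>j\<in>UNIV. ennreal (d i * d j) * ennreal ((X $ i $ j)\<^sup>2)) \<partial>wishart (mat 1) p)"
    unfolding n using d by (intro nn_integral_cong) (simp add: sum_ennreal less_imp_le sum_nonneg flip: ennreal_mult')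
  also have "\<dots> = (\<Sum>i\<in>UNIV. \<Sum>j\<in>UNIV. ennreal (d i * d j) * (\<integral>\<^sup>+X. ennreal ((X $ i $ j)\<^sup>2) \<partial>wishart (mat 1) p))"
    by (simp add: nn_integral_sum nn_integral_cmult borel_measurable_wishart)
  also have "\<dots> = (\<Sum>i\<in>UNIV. \<Sum>j\<in>UNIV. ennreal (d i * d j * (if i = j then p * (p + 2) else p)))"
    using d p0 by (simp add: std_wishart_moments(2)[OF p] less_imp_le ennreal_mult')
  also have "\<dots> = ennreal (\<Sum>i\<in>UNIV. \<Sum>j\<in>UNIV. d i * d j * (if i = j then p * (p + 2) else p))"
    using d p0 by (simp add: sum_ennreal less_imp_le sum_nonneg)
  also have "(\<Sum>i\<in>UNIV. \<Sum>j\<in>UNIV. d i * d j * (if i = j then p * (p + 2) else p)) =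
      (\<Sum>i\<in>UNIV. \<Sum>j\<in>UNIV. p * (d i * d j) + (if i = j then p * (p + 1) * (d i * d i) else 0))"
    by (intro sum.cong refl) (simp add: algebra_simps)
  also have "\<dots> = (\<Sum>i\<in>UNIV. \<Sum>j\<in>UNIV. p * (d i * d j)) +
      (\<Sum>i\<in>UNIV. \<Sum>j\<in>UNIV. if i = j then p * (p + 1) * (d i * d i) else 0)"
    by (simp only: sum.distrib)
  also have "(\<Sum>i\<in>UNIV. \<Sum>j\<in>UNIV. if i = j then p * (p + 1) * (d i * d i) else 0) =
      p * (p + 1) * (\<Sum>i\<in>UNIV. (d i)\<^sup>2)"
    by (simp add: power2_eq_square sum_distrib_left)
  also have "(\<Sum>i\<in>UNIV. \<Sum>j\<in>UNIV. p * (d i * d j)) = p * (\<Sum>i\<in>UNIV. d i)\<^sup>2"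
    unfolding power2_eq_square sum_product by (simp only: sum_distrib_left)
  also have "(\<Sum>i\<in>UNIV. d i) = trace S"
  proof -
    have "trace S = trace (Q ** (diag_matrix d ** transpose Q))" by (simp only: SQ matrix_mul_assoc)
    also have "\<dots> = trace (diag_matrix d ** transpose Q ** Q)" by (rule trace_mul_sym)
    also have "\<dots> = trace (diag_matrix d ** (transpose Q ** Q))" by (simp only: matrix_mul_assoc)
    finally show ?thesis using Q by (simp add: orthogonal_matrix trace_def diag_matrix_def)
  qed
  also have "(\<Sum>i\<in>UNIV. (d i)\<^sup>2) = (norm S)\<^sup>2"
    unfolding SQ norm_orthogonal_congruence[OF Q] norm_matrix_squared
    by (simp add: diag_matrix_def if_distrib[of "\<lambda>x. x\<^sup>2"] cong: if_cong)
  finally show ?thesis by (simp add: add.commute)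
qed

section \<open>Optimal transport between Wishart laws\<close>

lemma inner_matrix_trace:
  fixes U V :: "real^'n^'n"
  shows "U \<bullet> V = trace (transpose U ** V)"
proof -
  have "U \<bullet> V = (\<Sum>i\<in>UNIV. \<Sum>j\<in>UNIV. U $ i $ j * V $ i $ j)" by (simp add: inner_vec_def)
  also have "\<dots> = (\<Sum>j\<in>UNIV. \<Sum>i\<in>UNIV. U $ i $ j * V $ i $ j)" by (rule sum.swap)
  finally show ?thesis by (simp add: trace_def matrix_matrix_mult_def transpose_def)
qed

text \<open>
  Congruence by B and congruence by its inverse are adjoint inverses for the trace inner
  product.
\<close>

lemma inner_dual_congruence:
  fixes B X Y :: "real^'n^'n"
  assumes B: "B \<in> spd" and X: "transpose X = X"
  shows "(B ** X ** B) \<bullet> (matrix_inv B ** Y ** matrix_inv B) = X \<bullet> Y"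
proof -
  have i: "B ** matrix_inv B = mat 1" "matrix_inv B ** B = mat 1"
    using matrix_inv_inverse[OF spd_invertible[OF B]] by auto
  have "transpose (B ** X ** B) = B ** X ** B"
    using transpose_congruence[of B X] X by (simp add: spd_symmetric[OF B])
  then have "(B ** X ** B) \<bullet> (matrix_inv B ** Y ** matrix_inv B) =
      trace (B ** (X ** (B ** matrix_inv B) ** Y ** matrix_inv B))"
    by (simp add: inner_matrix_trace matrix_mul_assoc)
  also have "\<dots> = trace (X ** Y ** matrix_inv B ** B)"
    by (subst trace_mul_sym) (simp add: i)
  also have "\<dots> = trace (X ** Y ** (matrix_inv B ** B))" by (simp only: matrix_mul_assoc)
  also have "\<dots> = X \<bullet> Y" by (simp add: i inner_matrix_trace X)
  finally show ?thesis .
qed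

text \<open>
  With B' the inverse of B, the cost splits into functions of X alone, functions of Y alone and
  the square of B X B - B' Y B'. The latter is twice the duality gap of the convex potential
  X \<mapsto> |B X B|^2 / 2, whose gradient is X \<mapsto> B^2 X B^2.
\<close>

lemma quadratic_cost_identity:
  fixes B X Y :: "real^'n^'n"
  assumes B: "B \<in> spd" and X: "transpose X = X"
  shows "(norm (X - Y))\<^sup>2 + (norm (B ** X ** B))\<^sup>2 + (norm (matrix_inv B ** Y ** matrix_inv B))\<^sup>2 =
    (norm X)\<^sup>2 + (norm Y)\<^sup>2 + (norm (B ** X ** B - matrix_inv B ** Y ** matrix_inv B))\<^sup>2"
  using inner_dual_congruence[OF B X, of Y]
  by (simp add: power2_norm_eq_inner inner_diff_left inner_diff_right inner_commute)

text \<open>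
  The positive definite solution of A \<Sigma>0 A = \<Sigma>1: conjugating by the root of \<Sigma>0 turns this equation
  into C^2 = R \<Sigma>1 R, where R is that root.
\<close>

lemma wishart_brenier_matrix:
  fixes \<Sigma>0 \<Sigma>1 :: "real^'n^'n"
  assumes S0: "\<Sigma>0 \<in> spd" and S1: "\<Sigma>1 \<in> spd"
  defines "C \<equiv> spd_sqrt (spd_sqrt \<Sigma>0 ** \<Sigma>1 ** spd_sqrt \<Sigma>0)"
  defines "A \<equiv> matrix_inv (spd_sqrt \<Sigma>0) ** C ** matrix_inv (spd_sqrt \<Sigma>0)"
  shows "A \<in> spd" and "A ** \<Sigma>0 ** A = \<Sigma>1" and "trace (A ** \<Sigma>0) = trace C"
proof -
  define S where "S = spd_sqrt \<Sigma>0"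
  have S: "S \<in> spd" "S ** S = \<Sigma>0" using spd_sqrt[OF S0] by (simp_all add: S_def)
  define R where "R = matrix_inv S"
  have R: "R \<in> spd" using spd_matrix_inv[OF S(1)] by (simp add: R_def)
  have i: "S ** R = mat 1" "R ** S = mat 1"
    using matrix_inv_inverse[OF spd_invertible[OF S(1)]] by (auto simp: R_def)
  have "S ** \<Sigma>1 ** S \<in> spd"
    using spd_congruence[OF spd_invertible[OF S(1)] S1] by (simp add: spd_symmetric[OF S(1)])
  then have C: "C \<in> spd" "C ** C = S ** \<Sigma>1 ** S"
    using spd_sqrt by (simp_all add: C_def S_def)
  have A: "A = R ** C ** R" by (simp add: A_def R_def S_def)
  show "A \<in> spd"
    using spd_congruence[OF spd_invertible[OF R] C(1)] by (simp add: A spd_symmetric[OF R])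
  have "A ** \<Sigma>0 ** A = R ** C ** (R ** S) ** (S ** R) ** C ** R"
    by (simp add: A S(2)[symmetric] matrix_mul_assoc)
  also have "\<dots> = R ** (C ** C) ** R" by (simp add: i matrix_mul_assoc)
  also have "\<dots> = (R ** S) ** \<Sigma>1 ** (S ** R)" unfolding C(2) by (simp add: matrix_mul_assoc)
  finally show "A ** \<Sigma>0 ** A = \<Sigma>1" by (simp add: i)
  have "A ** \<Sigma>0 = R ** (C ** (R ** S) ** S)" by (simp add: A S(2)[symmetric] matrix_mul_assoc)
  then have "trace (A ** \<Sigma>0) = trace (C ** (R ** S) ** S ** R)" by (simp only: trace_mul_sym[of R])
  also have "\<dots> = trace (C ** (R ** S) ** (S ** R))" by (simp only: matrix_mul_assoc)
  finally show "trace (A ** \<Sigma>0) = trace C" by (simp add: i)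
qed

text \<open>
  The cost identity integrated over a pair (U, V) with the prescribed laws; M is the source law
  for a transport map and the coupling for a transport plan. By the choice of B, with inverse B', the
  matrices B U B and B' V B' both have the Wishart law with scale B \<Sigma>0 B, hence the same second
  moment. The subtracted terms appear on the left because the integrals take values in the
  extended nonnegative reals.
\<close>

lemma transport_cost_identity:
  fixes \<Sigma>0 \<Sigma>1 B :: "real^'n^'n"
  assumes p: "real CARD('n) - 1 < p" and S0: "\<Sigma>0 \<in> spd" and S1: "\<Sigma>1 \<in> spd" and B: "B \<in> spd"
    and eq: "(B ** B) ** \<Sigma>0 ** (B ** B) = \<Sigma>1"
    and U: "U \<in> M \<rightarrow>\<^sub>M wishart \<Sigma>0 p" "distr M (wishart \<Sigma>0 p) U = wishart \<Sigma>0 p"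
    and V: "V \<in> M \<rightarrow>\<^sub>M wishart \<Sigma>1 p" "distr M (wishart \<Sigma>1 p) V = wishart \<Sigma>1 p"
  defines "m \<equiv> \<lambda>S. p * (p + 1) * (norm S)\<^sup>2 + p * (trace S)\<^sup>2"
  shows "(\<integral>\<^sup>+z. frob_cost (U z) (V z) \<partial>M) + ennreal (2 * m (B ** \<Sigma>0 ** B)) =
    ennreal (m \<Sigma>0 + m \<Sigma>1) +
    (\<integral>\<^sup>+z. ennreal ((norm (B ** U z ** B - matrix_inv B ** V z ** matrix_inv B))\<^sup>2) \<partial>M)"
proof -
  define B' where "B' = matrix_inv B"
  have iB: "invertible B" using B by (rule spd_invertible)
  have B': "B' \<in> spd" "invertible B'" using spd_matrix_inv[OF B] by (auto simp: B'_def spd_invertible)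
  have i: "B ** B' = mat 1" "B' ** B = mat 1" using matrix_inv_inverse[OF iB] by (auto simp: B'_def)
  have t: "transpose B = B" "transpose B' = B'" using B B' by (auto simp: spd_symmetric)
  define N where "N = B ** \<Sigma>0 ** B"
  have N: "N \<in> spd" using spd_congruence[OF iB S0] by (simp add: N_def t)
  have N1: "B' ** \<Sigma>1 ** B' = N"
  proof -
    have "B' ** \<Sigma>1 ** B' = (B' ** B) ** (B ** \<Sigma>0 ** B) ** (B ** B')"
      unfolding eq[symmetric] by (simp only: matrix_mul_assoc)
    then show ?thesis by (simp add: i N_def)
  qed
  have p0: "0 < p" by (rule wishart_shape_pos[OF p])
  have m0: "0 \<le> m S" for S using p0 by (simp add: m_def)
  have U': "U \<in> borel_measurable M" "V \<in> borel_measurable M"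
    using measurable_compose[OF U(1) borel_measurable_wishart[of "\<lambda>x. x"]]
      measurable_compose[OF V(1) borel_measurable_wishart[of "\<lambda>x. x"]] by auto
  note U'[measurable]
  have intU: "(\<integral>\<^sup>+z. f (U z) \<partial>M) = (\<integral>\<^sup>+X. f X \<partial>wishart \<Sigma>0 p)"
    if "f \<in> borel_measurable borel" for f :: "real^'n^'n \<Rightarrow> ennreal"
    using nn_integral_distr[OF U(1), of f] by (simp add: U(2) borel_measurable_wishart that)
  have intV: "(\<integral>\<^sup>+z. f (V z) \<partial>M) = (\<integral>\<^sup>+X. f X \<partial>wishart \<Sigma>1 p)"
    if "f \<in> borel_measurable borel" for f :: "real^'n^'n \<Rightarrow> ennreal"
    using nn_integral_distr[OF V(1), of f] by (simp add: V(2) borel_measurable_wishart that)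
  have 1: "(\<integral>\<^sup>+z. ennreal ((norm (B ** U z ** B))\<^sup>2) \<partial>M) = ennreal (m N)"
  proof -
    have "(\<integral>\<^sup>+z. ennreal ((norm (B ** U z ** B))\<^sup>2) \<partial>M) = (\<integral>\<^sup>+X. ennreal ((norm (B ** X ** B))\<^sup>2) \<partial>wishart \<Sigma>0 p)"
      by (rule intU) measurable
    also have "\<dots> = (\<integral>\<^sup>+X. ennreal ((norm X)\<^sup>2) \<partial>wishart N p)"
      using nn_integral_wishart_congruence[OF iB S0, of "\<lambda>X. ennreal ((norm X)\<^sup>2)" p] by (simp add: t N_def)
    finally show ?thesis by (simp add: nn_integral_norm_squared_wishart[OF p N] m_def)
  qed
  have 2: "(\<integral>\<^sup>+z. ennreal ((norm (B' ** V z ** B'))\<^sup>2) \<partial>M) = ennreal (m N)"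
  proof -
    have "(\<integral>\<^sup>+z. ennreal ((norm (B' ** V z ** B'))\<^sup>2) \<partial>M) = (\<integral>\<^sup>+X. ennreal ((norm (B' ** X ** B'))\<^sup>2) \<partial>wishart \<Sigma>1 p)"
      by (rule intV) measurable
    also have "\<dots> = (\<integral>\<^sup>+X. ennreal ((norm X)\<^sup>2) \<partial>wishart N p)"
      using nn_integral_wishart_congruence[OF B'(2) S1, of "\<lambda>X. ennreal ((norm X)\<^sup>2)" p] by (simp add: t N1)
    finally show ?thesis by (simp add: nn_integral_norm_squared_wishart[OF p N] m_def)
  qed
  have 3: "(\<integral>\<^sup>+z. ennreal ((norm (U z))\<^sup>2) \<partial>M) = ennreal (m \<Sigma>0)"
    by (subst intU) (simp_all add: nn_integral_norm_squared_wishart[OF p S0] m_def)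
  have 4: "(\<integral>\<^sup>+z. ennreal ((norm (V z))\<^sup>2) \<partial>M) = ennreal (m \<Sigma>1)"
    by (subst intV) (simp_all add: nn_integral_norm_squared_wishart[OF p S1] m_def)
  have pt: "frob_cost (U z) (V z) + ennreal ((norm (B ** U z ** B))\<^sup>2) + ennreal ((norm (B' ** V z ** B'))\<^sup>2) =
      ennreal ((norm (U z))\<^sup>2) + ennreal ((norm (V z))\<^sup>2) + ennreal ((norm (B ** U z ** B - B' ** V z ** B'))\<^sup>2)"
    if "z \<in> space M" for z
  proof -
    have "U z \<in> spd" using measurable_space[OF U(1) that] by (simp add: space_wishart)
    from quadratic_cost_identity[OF B spd_symmetric[OF this], of "V z"] show ?thesis
      unfolding frob_cost_def B'_def by (simp flip: ennreal_plus)
  qed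
  have "(\<integral>\<^sup>+z. frob_cost (U z) (V z) + ennreal ((norm (B ** U z ** B))\<^sup>2) + ennreal ((norm (B' ** V z ** B'))\<^sup>2) \<partial>M) =
    (\<integral>\<^sup>+z. ennreal ((norm (U z))\<^sup>2) + ennreal ((norm (V z))\<^sup>2) + ennreal ((norm (B ** U z ** B - B' ** V z ** B'))\<^sup>2) \<partial>M)"
    by (intro nn_integral_cong pt)
  then have "(\<integral>\<^sup>+z. frob_cost (U z) (V z) \<partial>M) + ennreal (m N) + ennreal (m N) = ennreal (m \<Sigma>0) + ennreal (m \<Sigma>1) +
    (\<integral>\<^sup>+z. ennreal ((norm (B ** U z ** B - B' ** V z ** B'))\<^sup>2) \<partial>M)"
    by (simp add: nn_integral_add frob_cost_def 1 2 3 4)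
  moreover have "ennreal (2 * m N) = ennreal (m N) + ennreal (m N)"
    using m0 by (simp flip: ennreal_plus)
  moreover have "ennreal (m \<Sigma>0 + m \<Sigma>1) = ennreal (m \<Sigma>0) + ennreal (m \<Sigma>1)"
    using m0 by simp
  ultimately show ?thesis by (simp only: N_def B'_def add.assoc)
qed

theorem corollary2:
  fixes \<Sigma>0 \<Sigma>1 :: "real^'n^'n" and p :: real
  assumes "\<Sigma>0 \<in> spd" and "\<Sigma>1 \<in> spd" and "p > real CARD('n) - 1"
  defines "\<mu>0 \<equiv> wishart \<Sigma>0 p" and "\<mu>1 \<equiv> wishart \<Sigma>1 p"
  defines "C \<equiv> spd_sqrt (spd_sqrt \<Sigma>0 ** \<Sigma>1 ** spd_sqrt \<Sigma>0)"
  defines "A \<equiv> matrix_inv (spd_sqrt \<Sigma>0) ** spd_sqrt (spd_sqrt \<Sigma>0 ** \<Sigma>1 ** spd_sqrt \<Sigma>0)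
                 ** matrix_inv (spd_sqrt \<Sigma>0)"
  defines "T \<equiv> (\<lambda>X. A ** X ** A)"
  shows "(optimal_monge_map frob_cost \<mu>0 \<mu>1 T \<and>
          (\<forall>S. optimal_monge_map frob_cost \<mu>0 \<mu>1 S \<longrightarrow> (AE X in \<mu>0. S X = T X))) \<and>
         (optimal_plan frob_cost \<mu>0 \<mu>1 (distr \<mu>0 (\<mu>0 \<Otimes>\<^sub>M \<mu>1) (\<lambda>X. (X, T X))) \<and>
          (\<forall>\<Gamma>. optimal_plan frob_cost \<mu>0 \<mu>1 \<Gamma> \<longrightarrow>
                \<Gamma> = distr \<mu>0 (\<mu>0 \<Otimes>\<^sub>M \<mu>1) (\<lambda>X. (X, T X)))) \<and>
         enn2ereal (kantorovich frob_cost \<mu>0 \<mu>1) =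
           ereal (p * (p + 1) * (norm (\<Sigma>0 - \<Sigma>1))\<^sup>2
                  + p * ((trace \<Sigma>0)\<^sup>2 + (trace \<Sigma>1)\<^sup>2 - 2 * (trace C)\<^sup>2)) \<and>
         monge frob_cost \<mu>0 \<mu>1 = kantorovich frob_cost \<mu>0 \<mu>1"
proof -
  note S0 = assms(1) and S1 = assms(2) and p = assms(3)
  have A: "A \<in> spd" "A ** \<Sigma>0 ** A = \<Sigma>1" "trace (A ** \<Sigma>0) = trace C"
    using wishart_brenier_matrix[OF S0 S1] by (simp_all add: A_def C_def)
  have tA: "transpose A = A" by (rule spd_symmetric[OF A(1)])
  obtain B where B: "B \<in> spd" "B ** B = A" by (rule spd_sqrt_exists[OF A(1)])
  define B' where "B' = matrix_inv B"
  have i: "B ** B' = mat 1" "B' ** B = mat 1"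
    using matrix_inv_inverse[OF spd_invertible[OF B(1)]] by (auto simp: B'_def)
  have eq: "(B ** B) ** \<Sigma>0 ** (B ** B) = \<Sigma>1" by (simp add: B A)
  define defect where "defect X Y = ennreal ((norm (B ** X ** B - B' ** Y ** B'))\<^sup>2)" for X Y
  have defect_0: "defect X Y = 0 \<longleftrightarrow> Y = T X" for X Y
  proof -
    have "defect X Y = 0 \<longleftrightarrow> B ** X ** B = B' ** Y ** B'" by (simp add: defect_def)
    also have "\<dots> \<longleftrightarrow> Y = T X"
    proof
      assume "B ** X ** B = B' ** Y ** B'"
      then have "B ** (B ** X ** B) ** B = B ** (B' ** Y ** B') ** B" by simp
      also have "\<dots> = (B ** B') ** Y ** (B' ** B)" by (simp only: matrix_mul_assoc)
      also have "B ** (B ** X ** B) ** B = T X" by (simp add: T_def B(2)[symmetric] matrix_mul_assoc)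
      finally show "Y = T X" by (simp add: i)
    next
      assume "Y = T X"
      then have "B' ** Y ** B' = (B' ** B) ** B ** X ** B ** (B ** B')"
        by (simp add: T_def B(2)[symmetric] matrix_mul_assoc)
      then show "B ** X ** B = B' ** Y ** B'" by (simp add: i)
    qed
    finally show ?thesis .
  qed
  have defect_T: "defect X (T X) = 0" for X by (simp only: defect_0)
  \<comment> \<open>The second moment of a Wishart law as a function of its scale.\<close>
  define m where "m S = p * (p + 1) * (norm S)\<^sup>2 + p * (trace S)\<^sup>2" for S :: "real^'n^'n"
  define K where "K = p * (p + 1) * (norm (\<Sigma>0 - \<Sigma>1))\<^sup>2
                  + p * ((trace \<Sigma>0)\<^sup>2 + (trace \<Sigma>1)\<^sup>2 - 2 * (trace C)\<^sup>2)"
  have K: "K = m \<Sigma>0 + m \<Sigma>1 - 2 * m (B ** \<Sigma>0 ** B)"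
  proof -
    have "B' ** \<Sigma>1 ** B' = (B' ** B) ** (B ** \<Sigma>0 ** B) ** (B ** B')"
      unfolding eq[symmetric] by (simp only: matrix_mul_assoc)
    then have "B' ** \<Sigma>1 ** B' = B ** \<Sigma>0 ** B" by (simp add: i)
    then have n1: "(norm (B ** \<Sigma>0 ** B))\<^sup>2 = \<Sigma>0 \<bullet> \<Sigma>1"
      using inner_dual_congruence[OF B(1) spd_symmetric[OF S0], of \<Sigma>1]
      by (simp add: B'_def power2_norm_eq_inner)
    have n2: "trace (B ** \<Sigma>0 ** B) = trace C"
      using trace_mul_sym[of "B ** \<Sigma>0" B] A(3) by (simp add: matrix_mul_assoc B(2))
    have n3: "(norm (\<Sigma>0 - \<Sigma>1))\<^sup>2 = (norm \<Sigma>0)\<^sup>2 + (norm \<Sigma>1)\<^sup>2 - 2 * (\<Sigma>0 \<bullet> \<Sigma>1)"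
      by (simp add: power2_norm_eq_inner inner_diff_left inner_diff_right inner_commute)
    show ?thesis unfolding K_def m_def n1 n2 n3 by (simp add: algebra_simps)
  qed
  have cost: "(\<integral>\<^sup>+z. frob_cost (U z) (V z) \<partial>M) + ennreal (2 * m (B ** \<Sigma>0 ** B)) =
      ennreal (m \<Sigma>0 + m \<Sigma>1) + (\<integral>\<^sup>+z. defect (U z) (V z) \<partial>M)"
    if "U \<in> M \<rightarrow>\<^sub>M \<mu>0" "distr M \<mu>0 U = \<mu>0" "V \<in> M \<rightarrow>\<^sub>M \<mu>1" "distr M \<mu>1 V = \<mu>1"
    for M :: "'z measure" and U V
    using transport_cost_identity[OF p S0 S1 B(1) eq] that
    by (simp add: \<mu>0_def \<mu>1_def m_def defect_def B'_def)
  have T: "T \<in> \<mu>0 \<rightarrow>\<^sub>M \<mu>1" "distr \<mu>0 \<mu>1 T = \<mu>1"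
  proof -
    show "T \<in> \<mu>0 \<rightarrow>\<^sub>M \<mu>1"
      unfolding \<mu>0_def \<mu>1_def
    proof (rule measurable_wishart)
      show "T \<in> borel_measurable borel" unfolding T_def by measurable
      show "T X \<in> spd" if "X \<in> spd" for X
        using spd_congruence[OF spd_invertible[OF A(1)] that] by (simp add: T_def tA)
    qed
    show "distr \<mu>0 \<mu>1 T = \<mu>1"
      using distr_wishart_congruence[OF spd_invertible[OF A(1)] S0, of p p]
      by (simp add: \<mu>0_def \<mu>1_def T_def tA A(2))
  qed
  have p0: "0 < p" by (rule wishart_shape_pos[OF p])
  have m0: "0 \<le> m S" for S using p0 by (simp add: m_def)
  have id: "(\<lambda>X. X) \<in> \<mu>0 \<rightarrow>\<^sub>M \<mu>0" "distr \<mu>0 \<mu>0 (\<lambda>X. X) = \<mu>0" by simp_all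
  \<comment> \<open>T has no defect, so K is its cost.\<close>
  have K0: "0 \<le> K"
  proof -
    have "ennreal (2 * m (B ** \<Sigma>0 ** B)) \<le> (\<integral>\<^sup>+X. frob_cost X (T X) \<partial>\<mu>0) + ennreal (2 * m (B ** \<Sigma>0 ** B))"
      by simp
    also have "\<dots> = ennreal (m \<Sigma>0 + m \<Sigma>1)"
      by (subst cost[OF id T]) (simp add: defect_T)
    finally have "2 * m (B ** \<Sigma>0 ** B) \<le> m \<Sigma>0 + m \<Sigma>1"
      by (subst (asm) ennreal_le_iff) (simp_all add: m0)
    then show ?thesis by (simp add: K)
  qed
  have cost': "(\<integral>\<^sup>+z. frob_cost (U z) (V z) \<partial>M) = ennreal K + (\<integral>\<^sup>+z. defect (U z) (V z) \<partial>M)"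
    if "U \<in> M \<rightarrow>\<^sub>M \<mu>0" "distr M \<mu>0 U = \<mu>0" "V \<in> M \<rightarrow>\<^sub>M \<mu>1" "distr M \<mu>1 V = \<mu>1"
    for M :: "'z measure" and U V
  proof -
    have "ennreal (m \<Sigma>0 + m \<Sigma>1) = ennreal K + ennreal (2 * m (B ** \<Sigma>0 ** B))"
      using K0 m0 by (simp add: K flip: ennreal_plus)
    with cost[OF that] have "ennreal (2 * m (B ** \<Sigma>0 ** B)) + (\<integral>\<^sup>+z. frob_cost (U z) (V z) \<partial>M) =
        ennreal (2 * m (B ** \<Sigma>0 ** B)) + (ennreal K + (\<integral>\<^sup>+z. defect (U z) (V z) \<partial>M))"
      by (simp add: add_ac)
    then show ?thesis by (simp add: ennreal_add_left_cancel)
  qed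
  have meas_comp: "(\<lambda>z. F z) \<in> borel_measurable M" if "F \<in> M \<rightarrow>\<^sub>M wishart S q"
    for M :: "'z measure" and F and S :: "real^'n^'n" and q
    using measurable_compose[OF that borel_measurable_wishart[of "\<lambda>x. x"]] by simp
  have defect_meas: "(\<lambda>z. defect (U z) (V z)) \<in> borel_measurable M"
    if "U \<in> M \<rightarrow>\<^sub>M \<mu>0" "V \<in> M \<rightarrow>\<^sub>M \<mu>1" for M :: "'z measure" and U V
  proof -
    have [measurable]: "U \<in> borel_measurable M" "V \<in> borel_measurable M"
      using that meas_comp by (auto simp: \<mu>0_def \<mu>1_def)
    show ?thesis unfolding defect_def by measurable
  qed
  have no_defect: "AE z in M. V z = T (U z)"
    if "U \<in> M \<rightarrow>\<^sub>M \<mu>0" "V \<in> M \<rightarrow>\<^sub>M \<mu>1" and "ennreal K + (\<integral>\<^sup>+z. defect (U z) (V z) \<partial>M) = ennreal K"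
    for M :: "'z measure" and U V
  proof -
    have "(\<integral>\<^sup>+z. defect (U z) (V z) \<partial>M) = 0"
      using that(3) ennreal_add_left_cancel[of "ennreal K" _ 0] by simp
    then have "AE z in M. defect (U z) (V z) = 0"
      using nn_integral_0_iff_AE[OF defect_meas[OF that(1,2)]] by simp
    then show ?thesis by (simp only: defect_0)
  qed
  have map_cost: "monge_cost frob_cost \<mu>0 S = ennreal K + (\<integral>\<^sup>+X. defect X (S X) \<partial>\<mu>0)"
    if "S \<in> transport_maps \<mu>0 \<mu>1" for S
    using cost'[OF id, of S] that by (simp add: transport_maps_def monge_cost_def)
  have proj: "fst \<in> \<Gamma> \<rightarrow>\<^sub>M \<mu>0" "snd \<in> \<Gamma> \<rightarrow>\<^sub>M \<mu>1" "distr \<Gamma> \<mu>0 fst = \<mu>0" "distr \<Gamma> \<mu>1 snd = \<mu>1"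
    "sets \<Gamma> = sets (\<mu>0 \<Otimes>\<^sub>M \<mu>1)"
    if "\<Gamma> \<in> couplings \<mu>0 \<mu>1" for \<Gamma>
    using that by (auto simp: couplings_def cong: measurable_cong_sets)
  have plan_cost: "kantorovich_cost frob_cost \<Gamma> = ennreal K + (\<integral>\<^sup>+z. defect (fst z) (snd z) \<partial>\<Gamma>)"
    if "\<Gamma> \<in> couplings \<mu>0 \<mu>1" for \<Gamma>
    using cost'[OF proj(1,3)[OF that] proj(2,4)[OF that]] by (simp only: kantorovich_cost_def case_prod_unfold)
  define P where "P = distr \<mu>0 (\<mu>0 \<Otimes>\<^sub>M \<mu>1) (\<lambda>X. (X, T X))"
  have graph: "(\<lambda>X. (X, T X)) \<in> \<mu>0 \<rightarrow>\<^sub>M \<mu>0 \<Otimes>\<^sub>M \<mu>1" using T(1) by measurable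
  have P: "P \<in> couplings \<mu>0 \<mu>1"
  proof -
    have "prob_space P"
      unfolding P_def \<mu>0_def
      by (rule prob_space.prob_space_distr[OF prob_space_wishart[OF p S0]]) (use graph in \<open>simp add: \<mu>0_def\<close>)
    moreover have "distr P \<mu>0 fst = \<mu>0" "distr P \<mu>1 snd = \<mu>1"
      unfolding P_def using T(2) by (simp_all add: distr_distr[OF _ graph] o_def)
    ultimately show ?thesis by (simp add: couplings_def P_def)
  qed
  have T_map: "T \<in> transport_maps \<mu>0 \<mu>1" using T by (simp add: transport_maps_def)
  have T_cost: "monge_cost frob_cost \<mu>0 T = ennreal K"
    using map_cost[OF T_map] by (simp add: defect_T)
  have P_cost: "kantorovich_cost frob_cost P = ennreal K"
  proof -
    have "(\<integral>\<^sup>+z. defect (fst z) (snd z) \<partial>P) = (\<integral>\<^sup>+X. defect X (T X) \<partial>\<mu>0)"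
      unfolding P_def by (subst nn_integral_distr[OF graph]) (auto intro!: defect_meas)
    then show ?thesis using plan_cost[OF P] by (simp add: defect_T)
  qed
  have kant: "kantorovich frob_cost \<mu>0 \<mu>1 = ennreal K"
    unfolding kantorovich_def
  proof (rule antisym)
    show "(INF \<Gamma>\<in>couplings \<mu>0 \<mu>1. kantorovich_cost frob_cost \<Gamma>) \<le> ennreal K"
      using INF_lower[OF P, of "kantorovich_cost frob_cost"] by (simp add: P_cost)
    show "ennreal K \<le> (INF \<Gamma>\<in>couplings \<mu>0 \<mu>1. kantorovich_cost frob_cost \<Gamma>)"
      by (intro INF_greatest) (simp add: plan_cost)
  qed
  have mong: "monge frob_cost \<mu>0 \<mu>1 = ennreal K"
    unfolding monge_def
  proof (rule antisym)
    show "(INF S\<in>transport_maps \<mu>0 \<mu>1. monge_cost frob_cost \<mu>0 S) \<le> ennreal K"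
      using INF_lower[OF T_map, of "monge_cost frob_cost \<mu>0"] by (simp add: T_cost)
    show "ennreal K \<le> (INF S\<in>transport_maps \<mu>0 \<mu>1. monge_cost frob_cost \<mu>0 S)"
      by (intro INF_greatest) (simp add: map_cost)
  qed
  have unique_map: "AE X in \<mu>0. S X = T X" if "optimal_monge_map frob_cost \<mu>0 \<mu>1 S" for S
  proof -
    have S: "S \<in> transport_maps \<mu>0 \<mu>1" "monge_cost frob_cost \<mu>0 S = ennreal K"
      using that by (simp_all add: optimal_monge_map_def mong)
    then have "S \<in> \<mu>0 \<rightarrow>\<^sub>M \<mu>1" by (simp add: transport_maps_def)
    from no_defect[OF id(1) this] show ?thesis using S map_cost[OF S(1)] by simp
  qed
  have unique_plan: "\<Gamma> = P" if "optimal_plan frob_cost \<mu>0 \<mu>1 \<Gamma>" for \<Gamma>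
  proof -
    have G: "\<Gamma> \<in> couplings \<mu>0 \<mu>1" "kantorovich_cost frob_cost \<Gamma> = ennreal K"
      using that by (simp_all add: optimal_plan_def kant)
    note pr = proj[OF G(1)]
    have ae: "AE z in \<Gamma>. snd z = T (fst z)"
      using no_defect[OF pr(1,2)] G(2) plan_cost[OF G(1)] by simp
    have "\<Gamma> = distr \<Gamma> (\<mu>0 \<Otimes>\<^sub>M \<mu>1) (\<lambda>z. z)"
      using pr(5) by (simp add: distr_id2)
    also have "\<dots> = distr \<Gamma> (\<mu>0 \<Otimes>\<^sub>M \<mu>1) (\<lambda>z. (fst z, T (fst z)))"
    proof (rule distr_cong_AE[OF refl refl])
      show "AE z in \<Gamma>. z = (fst z, T (fst z))" using ae by (simp add: prod_eq_iff)
      show "(\<lambda>z. z) \<in> \<Gamma> \<rightarrow>\<^sub>M \<mu>0 \<Otimes>\<^sub>M \<mu>1" using pr(5) by (simp cong: measurable_cong_sets)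
      show "(\<lambda>z. (fst z, T (fst z))) \<in> \<Gamma> \<rightarrow>\<^sub>M \<mu>0 \<Otimes>\<^sub>M \<mu>1"
        by (intro measurable_Pair pr(1) measurable_compose[OF pr(1) T(1)])
    qed
    also have "\<dots> = distr (distr \<Gamma> \<mu>0 fst) (\<mu>0 \<Otimes>\<^sub>M \<mu>1) (\<lambda>X. (X, T X))"
      by (simp add: distr_distr[OF graph pr(1)] o_def)
    finally show ?thesis by (simp add: pr(3) P_def)
  qed
  show ?thesis
    unfolding P_def[symmetric] K_def[symmetric]
    using T_map P T_cost P_cost kant mong unique_map unique_plan K0
    by (simp add: optimal_monge_map_def[of _ _ _ T] optimal_plan_def[of _ _ _ P] enn2ereal_ennreal)
qed

end
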